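(* Let $(X,x)$ be a pointed (cubical) Kan complex that is $0$-connected (i.e. $\pi_0(X,x)$ is trivial). Then the Hurewicz homomorphism \[ \pi_1(X,x)\to\tilde H_1(X,x) \] is surjective, and its kernel is the commutator subgroup $[\pi_1(X,x),\pi_1(X,x)]$.
   Context: **Cubical sets.** The box category $\square$ has as objects the posets $[1]^n=\{0\le 1\}^n$ ($n\ge 0$), and its morphisms are the poset maps generated under composition by: faces $\partial^n_{i,\varepsilon}\colon [1]^{n-1}\to[1]^n$ ($1\le i\le n$, $\varepsilon\in\{0,1\}$), $(x_1,\dots,x_{n-1})\mapsto(x_1,\dots,x_{i-1},\varepsilon,x_i,\dots,x_{n-1})$; degeneracies $\sigma^n_i\colon[1]^n\to[1]^{n-1}$ ($1\le i\le n$), omitting the $i$-th coordinate; negative connections $\gamma^n_{i,0}\colon[1]^n\to[1]^{n-1}$ ($1\le i\le n-1$), replacing the pair $x_i,x_{i+1}$ by $\max\{x_i,x_{i+1}\}$; positive connections $\gamma^n_{i,1}\colon[1]^n\to[1]^{n-1}$ ($1\le i\le n-1$), replacing $x_i,x_{i+1}$ by $\min\{x_i,x_{i+1}\}$. A cubical set is a functor $X\colon\square^{op}\to\mathsf{Set}$; write $X_n=X([1]^n)$ for its set of $n$-cubes and write cubical operators on the right (e.g. $z\partial_{1,0}$). Cubical maps are natural transformations. $\square^n$ is the representable cubical set $\square(-,[1]^n)$; the open box $\sqcap^n_{i,\varepsilon}\subseteq\square^n$ is the union of the images of all faces $\partial_{j,\eta}$ with $(j,\eta)\ne(i,\varepsilon)$.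 A cubical set $K$ is a Kan complex if every map $\sqcap^n_{i,\varepsilon}\to K$ extends along $\sqcap^n_{i,\varepsilon}\hookrightarrow\square^n$. A pointed cubical set $(X,x)$ is a cubical set with a chosen $x\in X_0$. For $x\in X_0$, $x\sigma^{\circ n}\in X_n$ denotes the $n$-cube obtained from $x$ via the unique map $[1]^n\to[1]^0$. **Fundamental group.** For a pointed Kan complex $(X,x)$, the loop space $\Omega(X,x)$ is the cubical set whose $n$-cubes are the $(n+1)$-cubes $z$ of $X$ with $z\partial_{1,0}=z\partial_{1,1}=x\sigma^{\circ n}$, where $\varphi\colon[1]^m\to[1]^n$ acts on $z$ as $\mathrm{id}_{[1]}\times\varphi$ acts in $X$; its basepoint is $x\sigma_1$. It is again a Kan complex. $\pi_0$ of a cubical set $Y$ is its colimit, i.e. $Y_0$ modulo the equivalence relation generated by $e\partial_{1,0}\sim e\partial_{1,1}$, $e\in Y_1$. Set $\pi_1(X,x)=\pi_0\Omega(X,x)$. For $u,v\in\Omega(X,x)_0$, a concatenation square is a $2$-cube $s$ of $X$ with $s\partial_{1,0}=u$, $s\partial_{1,1}=x\sigma_1$, $s\partial_{2,1}=v$; then $s\partial_{2,0}$ is called a concatenation of $u$ and $v$. Setting $[u][v]=[s\partial_{2,0}]$ is a well-defined group structure on $\pi_1(X,x)$. **Homology.** A cubical abelian group is a functor $A\colon\square^{op}\to\mathsf{Ab}$. It yields a chain complex $A_\bullet$ with differential $\partial_n(a)=\sum_{i=1}^n\sum_{\varepsilon=0,1}(-1)^{i+\varepsilon}a\partial_{i,\varepsilon}$.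 The degenerate subcomplex $DA_\bullet$ has $DA_n\subseteq A_n$ the subgroup generated by all $a\sigma_i$ ($1\le i\le n$) and $a\gamma_{i,0}$ ($1\le i\le n-1$), $a\in A_{n-1}$ (so $DA_0=0$). The Moore complex is the quotient chain complex $\delta A=A_\bullet/DA_\bullet$. For a pointed cubical set $(X,x)$, $F(X,x)$ is the cubical abelian group with $F(X,x)_n$ the free abelian group on $X_n$ modulo the subgroup generated by $x\sigma^{\circ n}$; $F$ is left adjoint to $U$, $UA=(A,0)$, with unit $\eta_X\colon X\to UFX$. The underlying cubical set of every cubical abelian group is a Kan complex. Reduced homology is $\tilde H_n(X,x)=H_n(\delta F(X,x))$ (integer coefficients). **Hurewicz homomorphism.** For a cubical abelian group $A$ there is a natural isomorphism $\pi_1(UA,0)\cong H_1(\delta A)$ sending the class of a $1$-cube $a\in A_1$ both of whose faces are $0$ to the homology class of $a$. The Hurewicz homomorphism is the composite $\pi_1(X,x)\xrightarrow{\pi_1(\eta_X)}\pi_1(UFX,0)\cong H_1(\delta FX)=\tilde H_1(X,x)$. *)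

theory Defs
  imports "HOL-Algebra.Free_Abelian_Groups" "HOL-Algebra.Generated_Groups"
begin

section \<open>The box category\<close>

text \<open>
  The poset \<open>[1]^n\<close> is the set of Boolean lists of length \<open>n\<close>, with \<open>False\<close> for \<open>0\<close> and \<open>True\<close>
  for \<open>1\<close>; likewise for the endpoint \<open>\<epsilon>\<close> of a face or connection. The \<open>i\<close>-th coordinate
  (\<open>1 \<le> i \<le> n\<close>) of \<open>v\<close> is \<open>v ! (i - 1)\<close>. Morphisms are extensional functions, so that two morphisms
  with the same source and target are equal iff they agree on the source.
\<close>

definition vertices :: "nat \<Rightarrow> bool list set" where
  "vertices n = {v. length v = n}"

type_synonym box_map = "bool list \<Rightarrow> bool list"

definition face :: "nat \<Rightarrow> nat \<Rightarrow> bool \<Rightarrow> box_map" where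
  "face n i \<epsilon> = (\<lambda>v\<in>vertices (n - 1). take (i - 1) v @ [\<epsilon>] @ drop (i - 1) v)"

definition degen :: "nat \<Rightarrow> nat \<Rightarrow> box_map" where
  "degen n i = (\<lambda>v\<in>vertices n. take (i - 1) v @ drop i v)"

definition conn :: "nat \<Rightarrow> nat \<Rightarrow> bool \<Rightarrow> box_map" where
  "conn n i \<epsilon> = (\<lambda>v\<in>vertices n.
     take (i - 1) v @ [(if \<epsilon> then min else max) (v ! (i - 1)) (v ! i)] @ drop (i + 1) v)"

inductive box_hom :: "nat \<Rightarrow> nat \<Rightarrow> box_map \<Rightarrow> bool" where
  box_id: "box_hom n n (\<lambda>v\<in>vertices n. v)"
| box_face: "1 \<le> i \<Longrightarrow> i \<le> n \<Longrightarrow> box_hom (n - 1) n (face n i \<epsilon>)"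
| box_degen: "1 \<le> i \<Longrightarrow> i \<le> n \<Longrightarrow> box_hom n (n - 1) (degen n i)"
| box_conn: "1 \<le> i \<Longrightarrow> i + 1 \<le> n \<Longrightarrow> box_hom n (n - 1) (conn n i \<epsilon>)"
| box_comp: "box_hom l m \<phi> \<Longrightarrow> box_hom m n \<psi> \<Longrightarrow> box_hom l n (compose (vertices l) \<psi> \<phi>)"

definition terminal_map :: "nat \<Rightarrow> box_map" where
  "terminal_map n = (\<lambda>v\<in>vertices n. [])"

text \<open>The morphism \<open>id \<times> \<phi>\<close> from \<open>[1]^(m+1)\<close> to \<open>[1]^(n+1)\<close>, for \<open>\<phi>\<close> from \<open>[1]^m\<close> to \<open>[1]^n\<close>.\<close>

definition id_times :: "nat \<Rightarrow> box_map \<Rightarrow> box_map" where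
  "id_times m \<phi> = (\<lambda>v\<in>vertices (Suc m). hd v # \<phi> (tl v))"


section \<open>Cubical sets\<close>

text \<open>
  For \<open>\<phi>\<close> from \<open>[1]^m\<close> to \<open>[1]^n\<close>, the map \<open>act X m n \<phi>\<close> takes \<open>n\<close>-cubes to \<open>m\<close>-cubes.
  Values of \<open>act\<close> at other arguments carry no meaning.
\<close>

record 'a cubical =
  cells :: "nat \<Rightarrow> 'a set"
  act :: "nat \<Rightarrow> nat \<Rightarrow> box_map \<Rightarrow> 'a \<Rightarrow> 'a"

locale cubical_set =
  fixes X :: "'a cubical"
  assumes act_closed: "box_hom m n \<phi> \<Longrightarrow> z \<in> cells X n \<Longrightarrow> act X m n \<phi> z \<in> cells X m"
    and act_id: "z \<in> cells X n \<Longrightarrow> act X n n (\<lambda>v\<in>vertices n. v) z = z"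
    and act_comp: "box_hom l m \<phi> \<Longrightarrow> box_hom m n \<psi> \<Longrightarrow> z \<in> cells X n \<Longrightarrow>
      act X l n (compose (vertices l) \<psi> \<phi>) z = act X l m \<phi> (act X m n \<psi> z)"

text \<open>The \<open>(i,\<epsilon>)\<close>-face of an \<open>n\<close>-cube \<open>z\<close>.\<close>

abbreviation face_of :: "'a cubical \<Rightarrow> nat \<Rightarrow> nat \<Rightarrow> bool \<Rightarrow> 'a \<Rightarrow> 'a" where
  "face_of X n i \<epsilon> z \<equiv> act X (n - 1) n (face n i \<epsilon>) z"

definition const_cube :: "'a cubical \<Rightarrow> 'a \<Rightarrow> nat \<Rightarrow> 'a" where
  "const_cube X x n = act X n 0 (terminal_map n) x"

definition cubical_map :: "'a cubical \<Rightarrow> 'b cubical \<Rightarrow> (nat \<Rightarrow> 'a \<Rightarrow> 'b) \<Rightarrow> bool" where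
  "cubical_map X Y f \<longleftrightarrow>
     (\<forall>n. \<forall>z\<in>cells X n. f n z \<in> cells Y n) \<and>
     (\<forall>m n \<phi>. box_hom m n \<phi> \<longrightarrow>
        (\<forall>z\<in>cells X n. f m (act X m n \<phi> z) = act Y m n \<phi> (f n z)))"

definition standard_cube :: "nat \<Rightarrow> box_map cubical" where
  "standard_cube n =
     \<lparr>cells = (\<lambda>m. {\<chi>. box_hom m n \<chi>}),
      act = (\<lambda>l m \<phi> \<chi>. compose (vertices l) \<chi> \<phi>)\<rparr>"

definition open_box :: "nat \<Rightarrow> nat \<Rightarrow> bool \<Rightarrow> box_map cubical" where
  "open_box n i \<epsilon> =
     \<lparr>cells = (\<lambda>m. {compose (vertices m) (face n j \<eta>) \<psi> | j \<eta> \<psi>.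
                    1 \<le> j \<and> j \<le> n \<and> (j, \<eta>) \<noteq> (i, \<epsilon>) \<and> box_hom m (n - 1) \<psi>}),
      act = act (standard_cube n)\<rparr>"

definition kan_complex :: "'a cubical \<Rightarrow> bool" where
  "kan_complex K \<longleftrightarrow> cubical_set K \<and>
     (\<forall>n i \<epsilon> f. 1 \<le> i \<and> i \<le> n \<and> cubical_map (open_box n i \<epsilon>) K f \<longrightarrow>
        (\<exists>g. cubical_map (standard_cube n) K g \<and>
             (\<forall>m. \<forall>\<chi>\<in>cells (open_box n i \<epsilon>) m. g m \<chi> = f m \<chi>)))"

definition pointed_cubical_set :: "'a cubical \<Rightarrow> 'a \<Rightarrow> bool" where
  "pointed_cubical_set X x \<longleftrightarrow> cubical_set X \<and> x \<in> cells X 0"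


section \<open>Connected components and the fundamental group\<close>

definition pi0_rel :: "'a cubical \<Rightarrow> ('a \<times> 'a) set" where
  "pi0_rel Y = {(a, b). a \<in> cells Y 0 \<and> b \<in> cells Y 0 \<and>
     equivclp (\<lambda>a b. \<exists>e\<in>cells Y 1. a = face_of Y 1 1 False e \<and> b = face_of Y 1 1 True e) a b}"

definition pi0 :: "'a cubical \<Rightarrow> 'a set set" where
  "pi0 Y = cells Y 0 // pi0_rel Y"

definition pi0_class :: "'a cubical \<Rightarrow> 'a \<Rightarrow> 'a set" where
  "pi0_class Y a = pi0_rel Y `` {a}"

definition zero_connected :: "'a cubical \<Rightarrow> bool" where
  "zero_connected X \<longleftrightarrow> is_singleton (pi0 X)"

definition loop_space :: "'a cubical \<Rightarrow> 'a \<Rightarrow> 'a cubical" where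
  "loop_space X x =
     \<lparr>cells = (\<lambda>n. {z \<in> cells X (Suc n).
                    face_of X (Suc n) 1 False z = const_cube X x n \<and>
                    face_of X (Suc n) 1 True z = const_cube X x n}),
      act = (\<lambda>m n \<phi>. act X (Suc m) (Suc n) (id_times m \<phi>))\<rparr>"

definition const_loop :: "'a cubical \<Rightarrow> 'a \<Rightarrow> 'a" where
  "const_loop X x = act X 1 0 (degen 1 1) x"

definition concatenation_square :: "'a cubical \<Rightarrow> 'a \<Rightarrow> 'a \<Rightarrow> 'a \<Rightarrow> 'a \<Rightarrow> bool" where
  "concatenation_square X x u v s \<longleftrightarrow> s \<in> cells X 2 \<and>
     face_of X 2 1 False s = u \<and> face_of X 2 1 True s = const_loop X x \<and>
     face_of X 2 2 True s = v"

abbreviation loop_class :: "'a cubical \<Rightarrow> 'a \<Rightarrow> 'a \<Rightarrow> 'a set" where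
  "loop_class X x \<equiv> pi0_class (loop_space X x)"

text \<open>
  Here and below, an operation on equivalence classes or cosets is given by \<open>the_elem\<close> of the set
  of classes obtained from all choices of representatives (and of concatenation squares); this set
  is a singleton exactly when the operation is well defined.
\<close>

definition pi1 :: "'a cubical \<Rightarrow> 'a \<Rightarrow> 'a set monoid" where
  "pi1 X x =
     \<lparr>carrier = pi0 (loop_space X x),
      monoid.mult = (\<lambda>A B. the_elem {loop_class X x (face_of X 2 2 False s) | s u v.
                        u \<in> A \<and> v \<in> B \<and> concatenation_square X x u v s}),
      one = loop_class X x (const_loop X x)\<rparr>"

definition pi1_map ::
  "'b cubical \<Rightarrow> 'b \<Rightarrow> (nat \<Rightarrow> 'a \<Rightarrow> 'b) \<Rightarrow> 'a set \<Rightarrow> 'b set" where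
  "pi1_map Y y f C = the_elem ((\<lambda>u. loop_class Y y (f 1 u)) ` C)"


section \<open>Cubical abelian groups and homology\<close>

record 'a cubical_group =
  grp :: "nat \<Rightarrow> 'a monoid"
  gact :: "nat \<Rightarrow> nat \<Rightarrow> box_map \<Rightarrow> 'a \<Rightarrow> 'a"

definition underlying :: "'a cubical_group \<Rightarrow> 'a cubical" where
  "underlying A = \<lparr>cells = (\<lambda>n. carrier (grp A n)), act = gact A\<rparr>"

locale cubical_abelian_group = cubical_set "underlying A" for A :: "'a cubical_group" +
  assumes grp_comm_group: "comm_group (grp A n)"
    and gact_hom: "box_hom m n \<phi> \<Longrightarrow> gact A m n \<phi> \<in> hom (grp A n) (grp A m)"

text \<open>The map of quotients \<open>G/N \<rightarrow> H/M\<close> induced by \<open>f\<close>, where \<open>G/N\<close> is \<open>G Mod N\<close>.\<close>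

definition quotient_map ::
  "('b, 'm) monoid_scheme \<Rightarrow> 'b set \<Rightarrow> ('a \<Rightarrow> 'b) \<Rightarrow> 'a set \<Rightarrow> 'b set" where
  "quotient_map H M f C = the_elem ((\<lambda>c. M #>\<^bsub>H\<^esub> f c) ` C)"

text \<open>The abelian groups are written multiplicatively, so \<open>(-1)^(i+\<epsilon>)\<close> is an exponent.\<close>

definition cub_diff :: "'a cubical_group \<Rightarrow> nat \<Rightarrow> 'a \<Rightarrow> 'a" where
  "cub_diff A n a =
     (\<Otimes>\<^bsub>grp A (n - 1)\<^esub>i\<in>{1..n}. \<Otimes>\<^bsub>grp A (n - 1)\<^esub>\<epsilon>\<in>UNIV.
        gact A (n - 1) n (face n i \<epsilon>) a [^]\<^bsub>grp A (n - 1)\<^esub> ((- 1) ^ (i + of_bool \<epsilon>) :: int))"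

definition degenerate :: "'a cubical_group \<Rightarrow> nat \<Rightarrow> 'a set" where
  "degenerate A n = generate (grp A n)
     ({gact A n (n - 1) (degen n i) a | i a. 1 \<le> i \<and> i \<le> n \<and> a \<in> carrier (grp A (n - 1))} \<union>
      {gact A n (n - 1) (conn n i False) a | i a.
         1 \<le> i \<and> i + 1 \<le> n \<and> a \<in> carrier (grp A (n - 1))})"

text \<open>
  Chain complexes are concentrated in degrees \<open>n \<ge> 0\<close>; \<open>diff C n\<close> goes from degree \<open>n\<close> to degree
  \<open>n - 1\<close> and is used for \<open>n \<ge> 1\<close> only.
\<close>

record 'a chain_cx =
  chains :: "nat \<Rightarrow> 'a monoid"
  diff :: "nat \<Rightarrow> 'a \<Rightarrow> 'a"

definition cycles :: "'a chain_cx \<Rightarrow> nat \<Rightarrow> 'a set" where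
  "cycles C n = (if n = 0 then carrier (chains C 0)
                 else kernel (chains C n) (chains C (n - 1)) (diff C n))"

definition boundaries :: "'a chain_cx \<Rightarrow> nat \<Rightarrow> 'a set" where
  "boundaries C n = diff C (Suc n) ` carrier (chains C (Suc n))"

definition cycle_group :: "'a chain_cx \<Rightarrow> nat \<Rightarrow> 'a monoid" where
  "cycle_group C n = (chains C n)\<lparr>carrier := cycles C n\<rparr>"

definition homology :: "nat \<Rightarrow> 'a chain_cx \<Rightarrow> 'a set monoid" where
  "homology n C = cycle_group C n Mod boundaries C n"

definition homology_class :: "nat \<Rightarrow> 'a chain_cx \<Rightarrow> 'a \<Rightarrow> 'a set" where
  "homology_class n C c = boundaries C n #>\<^bsub>cycle_group C n\<^esub> c"

definition moore :: "'a cubical_group \<Rightarrow> 'a set chain_cx" where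
  "moore A =
     \<lparr>chains = (\<lambda>n. grp A n Mod degenerate A n),
      diff = (\<lambda>n. quotient_map (grp A (n - 1)) (degenerate A (n - 1)) (cub_diff A n))\<rparr>"

definition moore_class :: "'a cubical_group \<Rightarrow> nat \<Rightarrow> 'a \<Rightarrow> 'a set" where
  "moore_class A n a = degenerate A n #>\<^bsub>grp A n\<^esub> a"


section \<open>The free cubical abelian group and the Hurewicz homomorphism\<close>

definition base_subgroup :: "'a cubical \<Rightarrow> 'a \<Rightarrow> nat \<Rightarrow> ('a \<Rightarrow>\<^sub>0 int) set" where
  "base_subgroup X x n =
     generate (free_Abelian_group (cells X n)) {frag_of (const_cube X x n)}"

definition free_cubical :: "'a cubical \<Rightarrow> 'a \<Rightarrow> ('a \<Rightarrow>\<^sub>0 int) set cubical_group" where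
  "free_cubical X x =
     \<lparr>grp = (\<lambda>n. free_Abelian_group (cells X n) Mod base_subgroup X x n),
      gact = (\<lambda>m n \<phi>. quotient_map (free_Abelian_group (cells X m)) (base_subgroup X x m)
                        (frag_extend (\<lambda>z. frag_of (act X m n \<phi> z))))\<rparr>"

definition unit_map :: "'a cubical \<Rightarrow> 'a \<Rightarrow> nat \<Rightarrow> 'a \<Rightarrow> ('a \<Rightarrow>\<^sub>0 int) set" where
  "unit_map X x n z = base_subgroup X x n #>\<^bsub>free_Abelian_group (cells X n)\<^esub> frag_of z"

definition reduced_homology ::
  "nat \<Rightarrow> 'a cubical \<Rightarrow> 'a \<Rightarrow> ('a \<Rightarrow>\<^sub>0 int) set set set monoid" where
  "reduced_homology n X x = homology n (moore (free_cubical X x))"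

text \<open>
  The isomorphism from \<open>\<pi>\<^sub>1(UA, 0)\<close> to \<open>H\<^sub>1(\<delta>A)\<close>. The loops in \<open>UA\<close> at \<open>0\<close> are the \<open>1\<close>-cubes of
  \<open>A\<close> with both faces \<open>0\<close>.
\<close>

definition pi1_to_homology :: "'a cubical_group \<Rightarrow> 'a set \<Rightarrow> 'a set set" where
  "pi1_to_homology A C = the_elem ((\<lambda>a. homology_class 1 (moore A) (moore_class A 1 a)) ` C)"

definition hurewicz :: "'a cubical \<Rightarrow> 'a \<Rightarrow> 'a set \<Rightarrow> ('a \<Rightarrow>\<^sub>0 int) set set set" where
  "hurewicz X x C =
     (let A = free_cubical X x
      in pi1_to_homology A (pi1_map (underlying A) \<one>\<^bsub>grp A 0\<^esub> (unit_map X x) C))"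

end

theory Submission
  imports Defs
begin

text \<open>
  Squares of \<open>X\<close> are relations \<open>l t = b r\<close> between their sides, and filling open boxes of dimension
  three shows that five faces of a cube force the sixth; all group laws of \<open>\<pi>\<^sub>1\<close> are instances.
  The inverse of the Hurewicz map on the abelianization is explicit: choose a path from \<open>x\<close> to every vertex
  and let \<open>l(e)\<close> be the loop obtained from an edge \<open>e\<close> by conjugating with these paths. The cube law turns
  a square with sides \<open>e\<close> into a square with sides \<open>l(e)\<close>, so \<open>e \<mapsto> [l(e)]\<close> extends to the \<open>1\<close>-chains
  and kills degenerate chains and boundaries. Since \<open>[l(u)] = [u]\<close> for a loop \<open>u\<close>, a loop that is
  null-homologous lies in the commutator subgroup. For surjectivity, \<open>l(e)\<close> is homologous to
  \<open>e\<close> plus the chosen path to its start minus that to its end, and these corrections cancel in a cycle.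
\<close>

section \<open>Box maps and fillers of open boxes\<close>

text \<open>The box category has no map exchanging coordinates, so a square cannot be reflected in
  its diagonal; moving a side from the left to the bottom takes an argument, which rests on the
  negative connection. Squares carry four arbitrary sides so that concatenation (constant right
  side), homotopy (constant left and right sides) and straightening are shapes of one relation. The
  signs of the differential fit this reading: the boundary of a square is
  \<open>b + r - l - t\<close>, the additive form of \<open>l t = b r\<close>, so the same relation
  serves in the fundamental group and in homology. The path chosen for the base point itself has to
  be constant: in reduced chains the constant cubes at \<open>x\<close> are zero, and only then does
  a loop agree with its straightening.\<close>

lemma box_hom_in_vertices: "box_hom m n \<phi> \<Longrightarrow> v \<in> vertices m \<Longrightarrow> \<phi> v \<in> vertices n"
  by (induction arbitrary: v rule: box_hom.induct)
    (auto simp: vertices_def face_def degen_def conn_def compose_def)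

lemma box_hom_extensional: "box_hom m n \<phi> \<Longrightarrow> \<phi> \<in> extensional (vertices m)"
  by (induction rule: box_hom.induct)
    (simp_all only: face_def degen_def conn_def restrict_extensional compose_extensional)

lemma compose_id_right: "f \<in> extensional A \<Longrightarrow> compose A f (\<lambda>v\<in>A. v) = f"
  by (auto simp: compose_def extensional_def)

lemma compose_id_left: "(\<And>v. v \<in> A \<Longrightarrow> f v \<in> B) \<Longrightarrow> f \<in> extensional A \<Longrightarrow> compose A (\<lambda>v\<in>B. v) f = f"
  by (auto simp: compose_def extensional_def)

lemma compose_cong_on: "(\<And>v. v \<in> A \<Longrightarrow> g (f v) = g' (f' v)) \<Longrightarrow> compose A g f = compose A g' f'"
  by (auto simp: compose_def)

lemma compose_compose:
  "(\<And>v. v \<in> A \<Longrightarrow> f v \<in> B) \<Longrightarrow> compose A (compose B h g) f = compose A h (compose A g f)"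
  by (auto simp: compose_def)

lemma face_in_vertices: "1 \<le> i \<Longrightarrow> i \<le> n \<Longrightarrow> v \<in> vertices (n - 1) \<Longrightarrow> face n i \<epsilon> v \<in> vertices n"
  by (rule box_hom_in_vertices[OF box_face])

section \<open>Faces and degeneracies on vertices, and intersections of faces\<close>

lemma degen_face:
  "1 \<le> i \<Longrightarrow> i \<le> n \<Longrightarrow> v \<in> vertices (n - 1) \<Longrightarrow> degen n i (face n i \<epsilon> v) = v"
  by (auto simp: degen_def face_def vertices_def)

lemma face_degen:
  assumes "1 \<le> i" "i \<le> n" "v \<in> vertices n" "v ! (i - 1) = \<epsilon>"
  shows "face n i \<epsilon> (degen n i v) = v"
  using assms id_take_nth_drop[of "i - 1" v] by (auto simp: degen_def face_def vertices_def)

lemma nth_face_same: "1 \<le> i \<Longrightarrow> i \<le> n \<Longrightarrow> v \<in> vertices (n - 1) \<Longrightarrow> face n i \<epsilon> v ! (i - 1) = \<epsilon>"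
  by (auto simp: face_def vertices_def nth_append)

lemma nth_face_greater:
  "1 \<le> j \<Longrightarrow> j < k \<Longrightarrow> k \<le> n \<Longrightarrow> v \<in> vertices (n - 1) \<Longrightarrow> face n j \<eta> v ! (k - 1) = v ! (k - 2)"
  by (auto simp: face_def vertices_def nth_append nth_Cons' min_def numeral_2_eq_2)

lemma face_inject:
  "1 \<le> i \<Longrightarrow> i \<le> n \<Longrightarrow> v \<in> vertices (n - 1) \<Longrightarrow> w \<in> vertices (n - 1) \<Longrightarrow>
    face n i \<epsilon> v = face n i \<epsilon> w \<Longrightarrow> v = w"
  by (metis degen_face)

lemma face_face:
  assumes "1 \<le> j" "j < k" "k \<le> n" "v \<in> vertices (n - 2)"
  shows "face n k \<zeta> (face (n - 1) j \<eta> v) = face n j \<eta> (face (n - 1) (k - 1) \<zeta> v)"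
proof -
  \<comment> \<open>Coordinate \<open>j\<close> is inserted behind the block \<open>a\<close> and
    coordinate \<open>k\<close> behind \<open>b\<close>, so both composites are
    \<open>a @ \<eta> # b @ \<zeta> # c\<close>.\<close>
  define p q where "p = j - 1" and "q = k - 1 - j"
  define a b c where "a = take p v" and "b = take q (drop p v)" and "c = drop q (drop p v)"
  have v: "v = a @ b @ c" unfolding a_def b_def c_def by (metis append_take_drop_id)
  have jk: "j = Suc p" "k = Suc (Suc (p + q))" and l: "Suc (Suc (length v)) = n"
    using assms by (auto simp: vertices_def p_def q_def)
  have la: "length a = p" and lb: "length b = q"
    using assms l jk by (auto simp: a_def b_def)
  have f: "face m (Suc i) \<epsilon> w = take i w @ \<epsilon> # drop i w" if "Suc (length w) = m" for m i \<epsilon> w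
    using that by (auto simp: face_def vertices_def)
  have n: "n = Suc (Suc (p + (q + length c)))"
    using l v la lb by auto
  show ?thesis
    by (simp add: f jk v la lb n)
qed

text \<open>Faces in different directions meet in a face of codimension two, and this intersection
  is a pullback: the common factor is \<open>\<psi>\<close> with its coordinate number
  \<open>k - 1\<close> forgotten.\<close>

lemma box_hom_face_meet:
  assumes jk: "1 \<le> j" "j < k" "k \<le> n" and \<psi>: "box_hom m (n - 1) \<psi>" and \<psi>': "box_hom m (n - 1) \<psi>'"
    and eq: "compose (vertices m) (face n j \<eta>) \<psi> = compose (vertices m) (face n k \<zeta>) \<psi>'"
  obtains \<rho> where "box_hom m (n - 1 - 1) \<rho>"
    "\<psi> = compose (vertices m) (face (n - 1) (k - 1) \<zeta>) \<rho>"
    "\<psi>' = compose (vertices m) (face (n - 1) j \<eta>) \<rho>"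
proof -
  let ?\<rho> = "compose (vertices m) (degen (n - 1) (k - 1)) \<psi>"
  have \<rho>: "box_hom m (n - 1 - 1) ?\<rho>"
    using jk by (intro box_comp[OF \<psi>] box_degen) auto
  have pw: "\<psi> v = face (n - 1) (k - 1) \<zeta> (?\<rho> v) \<and> \<psi>' v = face (n - 1) j \<eta> (?\<rho> v)"
    if v: "v \<in> vertices m" for v
  proof -
    have \<psi>v: "\<psi> v \<in> vertices (n - 1)" "\<psi>' v \<in> vertices (n - 1)" and \<rho>v: "?\<rho> v \<in> vertices (n - 2)"
      using box_hom_in_vertices v \<psi> \<psi>' \<rho> by (force simp: numeral_2_eq_2)+
    have w: "face n j \<eta> (\<psi> v) = face n k \<zeta> (\<psi>' v)"
      using eq v by (metis compose_eq)
    \<comment> \<open>Coordinate \<open>k\<close> of the common vertex is \<open>\<zeta>\<close> by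
      its second description. In \<open>\<psi> v\<close>, where coordinate \<open>j\<close> is
      absent, it is number \<open>k - 1\<close>, hence at list index \<open>k - 2\<close>.\<close>
    have "\<psi> v ! (k - 2) = \<zeta>"
      using nth_face_greater[of j k n "\<psi> v" \<eta>] nth_face_same[of k n "\<psi>' v" \<zeta>] jk \<psi>v w by simp
    then have 1: "\<psi> v = face (n - 1) (k - 1) \<zeta> (?\<rho> v)"
      using face_degen[of "k - 1" "n - 1" "\<psi> v" \<zeta>] jk \<psi>v v
      by (simp add: compose_eq numeral_2_eq_2)
    then have "face n k \<zeta> (\<psi>' v) = face n k \<zeta> (face (n - 1) j \<eta> (?\<rho> v))"
      using face_face[OF jk \<rho>v] w by simp
    moreover have "face (n - 1) j \<eta> (?\<rho> v) \<in> vertices (n - 1)"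
      using jk \<rho>v by (intro face_in_vertices) (auto simp: numeral_2_eq_2)
    ultimately have "\<psi>' v = face (n - 1) j \<eta> (?\<rho> v)"
      using face_inject[of k n "\<psi>' v" "face (n - 1) j \<eta> (?\<rho> v)"] jk \<psi>v by simp
    with 1 show ?thesis by simp
  qed
  have "\<psi> = compose (vertices m) (face (n - 1) (k - 1) \<zeta>) ?\<rho>"
    "\<psi>' = compose (vertices m) (face (n - 1) j \<eta>) ?\<rho>"
    using pw box_hom_extensional[OF \<psi>] box_hom_extensional[OF \<psi>']
    by (auto simp: compose_def fun_eq_iff extensional_def)
  with \<rho> that show thesis by blast
qed

text \<open>Opposite faces are disjoint and every face map is injective, so parallel faces of a box
  impose no matching condition on each other.\<close>

lemma box_hom_face_unique:
  assumes "1 \<le> j" "j \<le> n" and \<psi>: "box_hom m (n - 1) \<psi>" and \<psi>': "box_hom m (n - 1) \<psi>'"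
    and eq: "compose (vertices m) (face n j \<eta>) \<psi> = compose (vertices m) (face n j \<zeta>) \<psi>'"
  shows "\<eta> = \<zeta>" "\<psi> = \<psi>'"
proof -
  have pw: "face n j \<eta> (\<psi> v) = face n j \<zeta> (\<psi>' v)" "\<psi> v \<in> vertices (n - 1)" "\<psi>' v \<in> vertices (n - 1)"
    if "v \<in> vertices m" for v
    using eq that box_hom_in_vertices \<psi> \<psi>' by (metis compose_eq, auto)
  \<comment> \<open>Some vertex is needed to compare the two endpoints.\<close>
  have v: "replicate m False \<in> vertices m" by (simp add: vertices_def)
  show \<eta>\<zeta>: "\<eta> = \<zeta>"
    using nth_face_same[of j n] pw[OF v] assms(1,2) by metis
  show "\<psi> = \<psi>'"
  proof (rule extensionalityI[OF box_hom_extensional[OF \<psi>] box_hom_extensional[OF \<psi>']])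
    show "\<psi> v = \<psi>' v" if "v \<in> vertices m" for v
      using pw[OF that] \<eta>\<zeta> by (auto intro: face_inject[OF assms(1,2), where \<epsilon> = \<zeta>])
  qed
qed

lemma face_of_face_of:
  assumes "cubical_set X" "z \<in> cells X n" "1 \<le> j" "j < k" "k \<le> n"
  shows "face_of X (n - 1) j \<eta> (face_of X n k \<zeta> z) = face_of X (n - 1) (k - 1) \<zeta> (face_of X n j \<eta> z)"
proof -
  interpret cubical_set X by fact
  have *: "compose (vertices (n - 1 - 1)) (face n k \<zeta>) (face (n - 1) j \<eta>) =
    compose (vertices (n - 1 - 1)) (face n j \<eta>) (face (n - 1) (k - 1) \<zeta>)"
    using assms(3-) face_face[of j k n] by (intro compose_cong_on) (simp add: numeral_2_eq_2)
  have f: "box_hom (n - 1 - 1) (n - 1) (face (n - 1) j \<eta>)"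
    "box_hom (n - 1 - 1) (n - 1) (face (n - 1) (k - 1) \<zeta>)"
    "box_hom (n - 1) n (face n j \<eta>)" "box_hom (n - 1) n (face n k \<zeta>)"
    using assms(3-) by (intro box_face; simp)+
  show ?thesis
    using act_comp[OF f(1) f(4) assms(2)] act_comp[OF f(2) f(3) assms(2)] * by simp
qed

text \<open>The Kan condition speaks of maps out of an open box. Such a map amounts to cubes on the
  faces that agree on pairwise intersections, and by Yoneda an extension to the whole cube amounts
  to one \<open>n\<close>-cube, the image of the identity.\<close>

lemma kan_complex_filler:
  assumes kan: "kan_complex K" and i: "1 \<le> i" "i \<le> n"
    and c: "\<And>j \<eta>. 1 \<le> j \<Longrightarrow> j \<le> n \<Longrightarrow> (j, \<eta>) \<noteq> (i, \<epsilon>) \<Longrightarrow> c j \<eta> \<in> cells K (n - 1)"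
    and compat: "\<And>j k \<eta> \<zeta>. 1 \<le> j \<Longrightarrow> j < k \<Longrightarrow> k \<le> n \<Longrightarrow> (j, \<eta>) \<noteq> (i, \<epsilon>) \<Longrightarrow> (k, \<zeta>) \<noteq> (i, \<epsilon>) \<Longrightarrow>
      face_of K (n - 1) (k - 1) \<zeta> (c j \<eta>) = face_of K (n - 1) j \<eta> (c k \<zeta>)"
  obtains z where "z \<in> cells K n"
    "\<And>j \<eta>. 1 \<le> j \<Longrightarrow> j \<le> n \<Longrightarrow> (j, \<eta>) \<noteq> (i, \<epsilon>) \<Longrightarrow> face_of K n j \<eta> z = c j \<eta>"
proof -
  interpret cubical_set K using kan by (simp add: kan_complex_def)
  define R where "R m \<chi> j \<eta> \<psi> \<longleftrightarrow> \<chi> = compose (vertices m) (face n j \<eta>) \<psi> \<and>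
    1 \<le> j \<and> j \<le> n \<and> (j, \<eta>) \<noteq> (i, \<epsilon>) \<and> box_hom m (n - 1) \<psi>" for m \<chi> j \<eta> \<psi>
  \<comment> \<open>A cell lying on several faces has several descriptions \<open>R\<close>; one is
    chosen here, and \<open>indep\<close> shows that the value does not depend on it.\<close>
  define f where "f m \<chi> = (SOME y. \<exists>j \<eta> \<psi>. R m \<chi> j \<eta> \<psi> \<and> y = act K m (n - 1) \<psi> (c j \<eta>))" for m \<chi>
  have indep': "act K m (n - 1) \<psi> (c j \<eta>) = act K m (n - 1) \<psi>' (c k \<zeta>)"
    if R: "R m \<chi> j \<eta> \<psi>" and R': "R m \<chi> k \<zeta> \<psi>'" and "j < k" for m \<chi> j \<eta> \<psi> k \<zeta> \<psi>'
  proof -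
    have jk: "1 \<le> j" "j < k" "k \<le> n" using R R' that by (auto simp: R_def)
    obtain \<rho> where \<rho>: "box_hom m (n - 1 - 1) \<rho>"
      "\<psi> = compose (vertices m) (face (n - 1) (k - 1) \<zeta>) \<rho>"
      "\<psi>' = compose (vertices m) (face (n - 1) j \<eta>) \<rho>"
      using box_hom_face_meet[OF jk, of m \<psi> \<psi>' \<eta> \<zeta>] R R' by (auto simp: R_def)
    have "box_hom (n - 1 - 1) (n - 1) (face (n - 1) (k - 1) \<zeta>)"
      "box_hom (n - 1 - 1) (n - 1) (face (n - 1) j \<eta>)"
      using jk by (intro box_face; simp)+
    moreover have "c j \<eta> \<in> cells K (n - 1)" "c k \<zeta> \<in> cells K (n - 1)"
      using R R' c unfolding R_def by blast+
    moreover have "face_of K (n - 1) (k - 1) \<zeta> (c j \<eta>) = face_of K (n - 1) j \<eta> (c k \<zeta>)"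
      using R R' compat jk unfolding R_def by blast
    ultimately show ?thesis using \<rho> by (simp add: act_comp)
  qed
  have indep: "act K m (n - 1) \<psi> (c j \<eta>) = act K m (n - 1) \<psi>' (c k \<zeta>)"
    if R: "R m \<chi> j \<eta> \<psi>" and R': "R m \<chi> k \<zeta> \<psi>'" for m \<chi> j \<eta> \<psi> k \<zeta> \<psi>'
  proof (cases j k rule: linorder_cases)
    case less
    then show ?thesis using indep' R R' by blast
  next
    case greater
    then show ?thesis using indep'[OF R' R] by simp
  next
    case equal
    have "1 \<le> j" "j \<le> n" "box_hom m (n - 1) \<psi>" "box_hom m (n - 1) \<psi>'"
      "compose (vertices m) (face n j \<eta>) \<psi> = compose (vertices m) (face n j \<zeta>) \<psi>'"
      using R R' equal unfolding R_def by blast+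
    from box_hom_face_unique[OF this] equal show ?thesis by simp
  qed
  have f_eq: "f m \<chi> = act K m (n - 1) \<psi> (c j \<eta>)" if R: "R m \<chi> j \<eta> \<psi>" for m \<chi> j \<eta> \<psi>
    unfolding f_def using R indep by (intro some_equality) blast+
  have cells: "\<chi> \<in> cells (open_box n i \<epsilon>) m \<longleftrightarrow> (\<exists>j \<eta> \<psi>. R m \<chi> j \<eta> \<psi>)" for m \<chi>
    unfolding open_box_def R_def by auto
  have "cubical_map (open_box n i \<epsilon>) K f"
    unfolding cubical_map_def
  proof (intro conjI allI ballI impI)
    fix m \<chi> assume "\<chi> \<in> cells (open_box n i \<epsilon>) m"
    then obtain j \<eta> \<psi> where R: "R m \<chi> j \<eta> \<psi>" using cells by blast
    then have "c j \<eta> \<in> cells K (n - 1)" "box_hom m (n - 1) \<psi>" using c by (auto simp: R_def)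
    then show "f m \<chi> \<in> cells K m" using f_eq[OF R] act_closed by simp
  next
    fix l m \<phi> \<chi> assume \<phi>: "box_hom l m \<phi>" and "\<chi> \<in> cells (open_box n i \<epsilon>) m"
    then obtain j \<eta> \<psi> where R: "R m \<chi> j \<eta> \<psi>" using cells by blast
    then have cj: "c j \<eta> \<in> cells K (n - 1)" "box_hom m (n - 1) \<psi>" using c by (auto simp: R_def)
    have R2: "R l (compose (vertices l) \<chi> \<phi>) j \<eta> (compose (vertices l) \<psi> \<phi>)"
      using R \<phi> box_comp[OF \<phi>, of "n - 1" \<psi>] box_hom_in_vertices[OF \<phi>] compose_compose[of "vertices l" \<phi> "vertices m"]
      by (auto simp: R_def)
    have "f l (compose (vertices l) \<chi> \<phi>) = act K l m \<phi> (f m \<chi>)"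
      using f_eq[OF R] f_eq[OF R2] act_comp[OF \<phi> cj(2,1)] by simp
    then show "f l (act (open_box n i \<epsilon>) l m \<phi> \<chi>) = act K l m \<phi> (f m \<chi>)"
      by (simp add: open_box_def standard_cube_def)
  qed
  then obtain g where g: "cubical_map (standard_cube n) K g"
    and gf: "\<And>m \<chi>. \<chi> \<in> cells (open_box n i \<epsilon>) m \<Longrightarrow> g m \<chi> = f m \<chi>"
    using kan i unfolding kan_complex_def by blast
  let ?id = "\<lambda>v\<in>vertices n. v"
  have id: "?id \<in> cells (standard_cube n) n" by (simp add: standard_cube_def box_id)
  show thesis
  proof (rule that[of "g n ?id"])
    show "g n ?id \<in> cells K n" using g id unfolding cubical_map_def by blast
    fix j \<eta> assume j: "1 \<le> j" "j \<le> n" "(j, \<eta>) \<noteq> (i, \<epsilon>)"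
    have F: "box_hom (n - 1) n (face n j \<eta>)" using j by (intro box_face)
    have "face_of K n j \<eta> (g n ?id) = g (n - 1) (compose (vertices (n - 1)) ?id (face n j \<eta>))"
      using g id F unfolding cubical_map_def by (simp add: standard_cube_def)
    also have "\<dots> = g (n - 1) (face n j \<eta>)"
      using compose_id_left[OF box_hom_in_vertices[OF F] box_hom_extensional[OF F]] by simp
    also have R: "R (n - 1) (face n j \<eta>) j \<eta> (\<lambda>v\<in>vertices (n - 1). v)"
      using j box_id compose_id_right[OF box_hom_extensional[OF F]] by (simp add: R_def)
    then have "g (n - 1) (face n j \<eta>) = f (n - 1) (face n j \<eta>)"
      using gf cells by blast
    also have "\<dots> = c j \<eta>"
      using f_eq[OF R] act_id c j by simp
    finally show "face_of K n j \<eta> (g n ?id) = c j \<eta>" .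
  qed
qed

section \<open>Edges and squares\<close>

text \<open>Dimensions are kept as numerals, so \<open>Suc 0\<close> is rewritten to \<open>1\<close> and not conversely.\<close>

declare One_nat_def [simp del] One_nat_def [symmetric, simp]

text \<open>An instance of \<open>face_of\<close> with its lower dimension evaluated, as is
  \<open>square_side\<close>; this keeps \<open>n - 1\<close> out of later goals.\<close>

definition edge_end :: "'a cubical \<Rightarrow> bool \<Rightarrow> 'a \<Rightarrow> 'a" where
  "edge_end X \<epsilon> e = act X 0 1 (face 1 1 \<epsilon>) e"

definition square_side :: "'a cubical \<Rightarrow> nat \<Rightarrow> bool \<Rightarrow> 'a \<Rightarrow> 'a" where
  "square_side X i \<epsilon> s = act X 1 2 (face 2 i \<epsilon>) s"

text \<open>The square has left side \<open>l\<close>, top \<open>t\<close>, bottom \<open>b\<close> and right side \<open>r\<close>, the first coordinate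
  being horizontal; for loops it will say that \<open>l t = b r\<close>.\<close>

definition square :: "'a cubical \<Rightarrow> 'a \<Rightarrow> 'a \<Rightarrow> 'a \<Rightarrow> 'a \<Rightarrow> bool" where
  "square X l t b r \<longleftrightarrow> (\<exists>s\<in>cells X 2. square_side X 1 False s = l \<and> square_side X 2 True s = t \<and>
     square_side X 2 False s = b \<and> square_side X 1 True s = r)"

lemma vertices_0: "vertices 0 = {[]}"
  by (auto simp: vertices_def)

lemma vertices_1: "v \<in> vertices 1 \<longleftrightarrow> (\<exists>a. v = [a])"
  unfolding vertices_def mem_Collect_eq One_nat_def length_Suc_conv by auto

lemma terminal_map_degen: "terminal_map 1 = degen 1 1"
  by (auto simp: terminal_map_def degen_def fun_eq_iff vertices_1 restrict_def)

lemma terminal_map_compose: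
  "box_hom m n \<phi> \<Longrightarrow> compose (vertices m) (terminal_map n) \<phi> = terminal_map m"
  using box_hom_in_vertices by (auto simp: terminal_map_def compose_def fun_eq_iff restrict_def)

text \<open>Coordinates are dropped one at a time: the map to the point is a composite of
  degeneracies.\<close>

lemma box_hom_terminal: "box_hom n 0 (terminal_map n)"
proof (induction n)
  case 0
  have "terminal_map 0 = (\<lambda>v\<in>vertices 0. v)"
    by (auto simp: terminal_map_def vertices_0 restrict_def)
  then show ?case using box_id[of 0] by metis
next
  case (Suc n)
  have d: "box_hom (Suc n) n (degen (Suc n) 1)" using box_degen[of 1 "Suc n"] by simp
  from box_comp[OF d Suc] terminal_map_compose[OF d] show ?case by simp
qed

context cubical_set
begin

lemma edge_end_closed: "e \<in> cells X 1 \<Longrightarrow> edge_end X \<epsilon> e \<in> cells X 0"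
  using act_closed[OF box_face[of 1 1 \<epsilon>]] by (simp add: edge_end_def)

lemma square_side_closed: "i \<in> {1, 2} \<Longrightarrow> s \<in> cells X 2 \<Longrightarrow> square_side X i \<epsilon> s \<in> cells X 1"
  using act_closed[OF box_face[of i 2 \<epsilon>]] by (auto simp: square_side_def)

lemma const_loop_closed: "v \<in> cells X 0 \<Longrightarrow> const_loop X v \<in> cells X 1"
  using act_closed[OF box_degen[of 1 1]] by (simp add: const_loop_def)

text \<open>The corner \<open>(\<eta>, \<epsilon>)\<close> is an end of two sides. These four
  equations are the only conditions on the boundary of a square.\<close>

lemma edge_end_square_side:
  assumes "s \<in> cells X 2"
  shows "edge_end X \<epsilon> (square_side X 1 \<eta> s) = edge_end X \<eta> (square_side X 2 \<epsilon> s)"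
  using face_of_face_of[OF cubical_set_axioms assms, of 1 2 \<eta> \<epsilon>]
  by (simp add: edge_end_def square_side_def)

lemma edge_end_const_loop:
  assumes "v \<in> cells X 0"
  shows "edge_end X \<epsilon> (const_loop X v) = v"
proof -
  have "compose (vertices 0) (degen 1 1) (face 1 1 \<epsilon>) = (\<lambda>v\<in>vertices 0. v)"
    by (auto simp: fun_eq_iff compose_def vertices_0 degen_def face_def vertices_1 restrict_def)
  moreover have "box_hom 0 1 (face 1 1 \<epsilon>)" "box_hom 1 0 (degen 1 1)"
    using box_face[of 1 1] box_degen[of 1 1] by simp_all
  ultimately show ?thesis
    unfolding edge_end_def const_loop_def using act_comp[of 0 1 _ 0 _ v] act_id[of v 0] assms
    by metis
qed

text \<open>A side of a degenerate square is \<open>e\<close> acted on by the restriction of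
  \<open>\<phi>\<close> to that side; the restriction is either the identity of the interval or
  factors through the endpoint \<open>\<eta>\<close>.\<close>

lemma act_face_degenerate:
  assumes "i \<in> {1, 2}" and e: "e \<in> cells X 1" and \<phi>: "box_hom 2 1 \<phi>"
  shows "(\<And>a. \<phi> (face 2 i \<epsilon> [a]) = [a]) \<Longrightarrow> square_side X i \<epsilon> (act X 2 1 \<phi> e) = e"
    and "(\<And>a. \<phi> (face 2 i \<epsilon> [a]) = [\<eta>]) \<Longrightarrow>
      square_side X i \<epsilon> (act X 2 1 \<phi> e) = const_loop X (edge_end X \<eta> e)"
proof -
  have F: "box_hom 1 2 (face 2 i \<epsilon>)" "box_hom 0 1 (face 1 1 \<eta>)" "box_hom 1 0 (degen 1 1)"
    using box_face[of i 2] box_face[of 1 1] box_degen[of 1 1] assms by auto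
  have *: "square_side X i \<epsilon> (act X 2 1 \<phi> e) = act X 1 1 (compose (vertices 1) \<phi> (face 2 i \<epsilon>)) e"
    unfolding square_side_def using act_comp[OF F(1) \<phi> e] by simp
  show "square_side X i \<epsilon> (act X 2 1 \<phi> e) = e" if "\<And>a. \<phi> (face 2 i \<epsilon> [a]) = [a]"
  proof -
    have "compose (vertices 1) \<phi> (face 2 i \<epsilon>) = (\<lambda>v\<in>vertices 1. v)"
      using that by (auto simp: fun_eq_iff compose_def vertices_1 restrict_def)
    then show ?thesis using * act_id e by simp
  qed
  show "square_side X i \<epsilon> (act X 2 1 \<phi> e) = const_loop X (edge_end X \<eta> e)"
    if "\<And>a. \<phi> (face 2 i \<epsilon> [a]) = [\<eta>]"
  proof -
    have "face 1 1 \<eta> (degen 1 1 [a]) = [\<eta>]" for a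
      by (simp add: face_def degen_def vertices_def drop_Cons' take_Cons')
    then have "compose (vertices 1) \<phi> (face 2 i \<epsilon>) = compose (vertices 1) (face 1 1 \<eta>) (degen 1 1)"
      using that by (auto simp: fun_eq_iff compose_def vertices_1 restrict_def)
    then show ?thesis unfolding * edge_end_def const_loop_def using act_comp[OF F(3,2) e] by simp
  qed
qed

lemma face_2: "face 2 1 \<epsilon> [a] = [\<epsilon>, a]" "face 2 2 \<epsilon> [a] = [a, \<epsilon>]"
  by (simp_all add: face_def vertices_def)

lemma degen_2: "degen 2 1 [a, b] = [b]" "degen 2 2 [a, b] = [a]"
  by (simp_all add: degen_def vertices_def drop_Cons' take_Cons')

lemma conn_2: "conn 2 1 False [a, b] = [max a b]"
  by (simp add: conn_def vertices_def nth_Cons')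

lemma degen_1_sides:
  assumes e: "e \<in> cells X 1"
  shows "square_side X 1 \<epsilon> (act X 2 1 (degen 2 1) e) = e"
    "square_side X 2 \<epsilon> (act X 2 1 (degen 2 1) e) = const_loop X (edge_end X \<epsilon> e)"
  using box_degen[of 1 2] e
  by (auto intro!: act_face_degenerate simp: face_2 degen_2)

lemma degen_2_sides:
  assumes e: "e \<in> cells X 1"
  shows "square_side X 1 \<epsilon> (act X 2 1 (degen 2 2) e) = const_loop X (edge_end X \<epsilon> e)"
    "square_side X 2 \<epsilon> (act X 2 1 (degen 2 2) e) = e"
  using box_degen[of 2 2] e
  by (auto intro!: act_face_degenerate simp: face_2 degen_2)

lemma conn_sides:
  assumes e: "e \<in> cells X 1" and i: "i \<in> {1, 2}"
  shows "square_side X i False (act X 2 1 (conn 2 1 False) e) = e"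
    "square_side X i True (act X 2 1 (conn 2 1 False) e) = const_loop X (edge_end X True e)"
  using box_conn[of 1 2] e i
  by (auto intro!: act_face_degenerate simp: face_2 conn_2 max_def)

text \<open>These come from the two degeneracies and the negative connection; as equations they read
  \<open>e 1 = 1 e\<close>, \<open>1 e = e 1\<close> and \<open>e 1 = e 1\<close>. Only the third
  has the same edge \<open>e\<close> on the adjacent sides left and bottom, which is what allows a
  side to be moved round a corner.\<close>

lemma degenerate_squares:
  assumes e: "e \<in> cells X 1"
  shows "square X e (const_loop X (edge_end X True e)) (const_loop X (edge_end X False e)) e"
    and "square X (const_loop X (edge_end X False e)) e e (const_loop X (edge_end X True e))"
    and "square X e (const_loop X (edge_end X True e)) e (const_loop X (edge_end X True e))"
proof -
  have "act X 2 1 (degen 2 1) e \<in> cells X 2" "act X 2 1 (degen 2 2) e \<in> cells X 2"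
    "act X 2 1 (conn 2 1 False) e \<in> cells X 2"
    using act_closed e box_degen[of 1 2] box_degen[of 2 2] box_conn[of 1 2] by simp_all
  note c = this[THEN bexI[rotated]]
  show "square X e (const_loop X (edge_end X True e)) (const_loop X (edge_end X False e)) e"
    and "square X (const_loop X (edge_end X False e)) e e (const_loop X (edge_end X True e))"
    and "square X e (const_loop X (edge_end X True e)) e (const_loop X (edge_end X True e))"
    unfolding square_def by (rule c(1), simp add: degen_1_sides e)
      (rule c(2), simp add: degen_2_sides e, rule c(3), simp add: conn_sides e)
qed

lemma const_cube_closed: "v \<in> cells X 0 \<Longrightarrow> const_cube X v n \<in> cells X n"
  unfolding const_cube_def by (rule act_closed[OF box_hom_terminal])

lemma act_const_cube:
  "v \<in> cells X 0 \<Longrightarrow> box_hom m n \<phi> \<Longrightarrow> act X m n \<phi> (const_cube X v n) = const_cube X v m"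
  unfolding const_cube_def using act_comp[OF _ box_hom_terminal] by (metis terminal_map_compose)

lemma const_cube_0: "v \<in> cells X 0 \<Longrightarrow> const_cube X v 0 = v"
  using act_id[of v 0] by (simp add: const_cube_def terminal_map_def vertices_0 restrict_def cong: if_cong)

lemma const_cube_1: "const_cube X v 1 = const_loop X v"
  by (simp only: const_cube_def terminal_map_degen const_loop_def)

end

section \<open>Fillers of open squares and open 3-cubes\<close>

locale kan = cubical_set +
  assumes kan: "kan_complex X"
begin

lemma square_filler:
  assumes "i \<in> {1, 2}"
    and c: "\<And>j \<eta>. j \<in> {1, 2} \<Longrightarrow> (j, \<eta>) \<noteq> (i, \<epsilon>) \<Longrightarrow> c j \<eta> \<in> cells X 1"
    and compat: "\<And>\<eta> \<zeta>. (1, \<eta>) \<noteq> (i, \<epsilon>) \<Longrightarrow> (2, \<zeta>) \<noteq> (i, \<epsilon>) \<Longrightarrow> edge_end X \<zeta> (c 1 \<eta>) = edge_end X \<eta> (c 2 \<zeta>)"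
  obtains s where "s \<in> cells X 2"
    "\<And>j \<eta>. j \<in> {1, 2} \<Longrightarrow> (j, \<eta>) \<noteq> (i, \<epsilon>) \<Longrightarrow> square_side X j \<eta> s = c j \<eta>"
proof -
  have "c j \<eta> \<in> cells X (2 - 1)" if "1 \<le> j" "j \<le> 2" "(j, \<eta>) \<noteq> (i, \<epsilon>)" for j \<eta>
  proof -
    have "j \<in> {1, 2}" using that by auto
    then show ?thesis using c that by simp
  qed
  moreover have "face_of X (2 - 1) (k - 1) \<zeta> (c j \<eta>) = face_of X (2 - 1) j \<eta> (c k \<zeta>)"
    if "1 \<le> j" "j < k" "k \<le> 2" "(j, \<eta>) \<noteq> (i, \<epsilon>)" "(k, \<zeta>) \<noteq> (i, \<epsilon>)" for j k \<eta> \<zeta>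
  proof -
    have jk: "j = 1" "k = 2" using that by auto
    show ?thesis using compat[of \<eta> \<zeta>] that(4,5) unfolding jk by (simp add: edge_end_def)
  qed
  moreover have "1 \<le> i" "i \<le> 2" using assms(1) by auto
  ultimately obtain s where s: "s \<in> cells X 2"
    "\<And>j \<eta>. 1 \<le> j \<Longrightarrow> j \<le> 2 \<Longrightarrow> (j, \<eta>) \<noteq> (i, \<epsilon>) \<Longrightarrow> face_of X 2 j \<eta> s = c j \<eta>"
    using kan_complex_filler[OF kan, of i 2 \<epsilon> c] by blast
  show thesis
  proof (rule that[OF s(1)])
    fix j :: nat and \<eta> assume "j \<in> {1, 2}" "(j, \<eta>) \<noteq> (i, \<epsilon>)"
    then have "1 \<le> j" "j \<le> 2" "(j, \<eta>) \<noteq> (i, \<epsilon>)" by auto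
    from s(2)[OF this] show "square_side X j \<eta> s = c j \<eta>" by (simp add: square_side_def)
  qed
qed

text \<open>With the bottom missing the filler composes: \<open>b\<close> plays the role of
  \<open>l t\<close> followed by the reverse of \<open>r\<close>. With the left side missing, as in
  \<open>square_left_filler\<close>, it divides: \<open>l\<close> is \<open>b r\<close> followed by
  the reverse of \<open>t\<close>.\<close>

lemma square_bottom_filler:
  assumes "l \<in> cells X 1" "t \<in> cells X 1" "r \<in> cells X 1"
    and "edge_end X True l = edge_end X False t" "edge_end X True t = edge_end X True r"
  obtains b where "square X l t b r"
proof -
  let ?c = "\<lambda>j \<eta>. if j = (2::nat) then t else if \<eta> then r else l"
  obtain s where "s \<in> cells X 2"
    and s: "\<And>j \<eta>. j \<in> {1, 2} \<Longrightarrow> (j, \<eta>) \<noteq> (2, False) \<Longrightarrow> square_side X j \<eta> s = ?c j \<eta>"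
    by (rule square_filler[of 2 False ?c]) (use assms in auto)
  with s[of 1 False] s[of 1 True] s[of 2 True] have "square X l t (square_side X 2 False s) r"
    unfolding square_def by (intro bexI[of _ s]) simp_all
  then show thesis by (rule that)
qed

lemma square_left_filler:
  assumes "t \<in> cells X 1" "b \<in> cells X 1" "r \<in> cells X 1"
    and "edge_end X True b = edge_end X False r" "edge_end X True t = edge_end X True r"
  obtains l where "square X l t b r"
proof -
  let ?c = "\<lambda>j \<eta>. if j = (1::nat) then r else if \<eta> then t else b"
  obtain s where "s \<in> cells X 2"
    and s: "\<And>j \<eta>. j \<in> {1, 2} \<Longrightarrow> (j, \<eta>) \<noteq> (1, False) \<Longrightarrow> square_side X j \<eta> s = ?c j \<eta>"
    by (rule square_filler[of 1 False ?c]) (use assms in auto)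
  with s[of 1 True] s[of 2 False] s[of 2 True] have "square X (square_side X 1 False s) t b r"
    unfolding square_def by (intro bexI[of _ s]) simp_all
  then show thesis by (rule that)
qed

text \<open>The edge of the cube parallel to the \<open>j\<close>-th axis is \<open>E j\<close> applied to its other two coordinates.\<close>

definition cube_face :: "(nat \<Rightarrow> bool \<Rightarrow> bool \<Rightarrow> 'a) \<Rightarrow> nat \<Rightarrow> bool \<Rightarrow> bool \<Rightarrow> nat \<Rightarrow> 'a" where
  "cube_face E k \<epsilon> \<eta> i = (if k = 1 then if i = 1 then E 3 \<epsilon> \<eta> else E 2 \<epsilon> \<eta>
     else if k = 2 then if i = 1 then E 3 \<eta> \<epsilon> else E 1 \<epsilon> \<eta>
     else if i = 1 then E 2 \<eta> \<epsilon> else E 1 \<eta> \<epsilon>)"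

text \<open>Only the existence of the squares matters, so five of them are chosen. Being described
  by the same twelve edges \<open>E\<close>, they agree wherever two of them meet, and the missing
  face of a filler is the sixth square.\<close>

lemma cube_law:
  assumes i: "i \<in> {1, 2, 3}"
    and faces: "\<And>k \<zeta>. k \<in> {1, 2, 3} \<Longrightarrow> (k, \<zeta>) \<noteq> (i, \<epsilon>) \<Longrightarrow>
      square X (cube_face E k \<zeta> False 1) (cube_face E k \<zeta> True 2) (cube_face E k \<zeta> False 2) (cube_face E k \<zeta> True 1)"
  shows "square X (cube_face E i \<epsilon> False 1) (cube_face E i \<epsilon> True 2) (cube_face E i \<epsilon> False 2) (cube_face E i \<epsilon> True 1)"
proof -
  have "\<exists>s. k \<in> {1, 2, 3} \<and> (k, \<zeta>) \<noteq> (i, \<epsilon>) \<longrightarrow> s \<in> cells X 2 \<and>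
      (\<forall>j\<in>{1, 2}. \<forall>\<eta>. square_side X j \<eta> s = cube_face E k \<zeta> \<eta> j)" for k \<zeta>
  proof (cases "k \<in> {1, 2, 3} \<and> (k, \<zeta>) \<noteq> (i, \<epsilon>)")
    case True
    then obtain s where "s \<in> cells X 2" "square_side X 1 False s = cube_face E k \<zeta> False 1"
      "square_side X 2 True s = cube_face E k \<zeta> True 2" "square_side X 2 False s = cube_face E k \<zeta> False 2"
      "square_side X 1 True s = cube_face E k \<zeta> True 1"
      using faces[of k \<zeta>] unfolding square_def by blast
    then show ?thesis by (intro exI[of _ s]) (simp add: all_bool_eq)
  qed auto
  then obtain s where s: "\<And>k \<zeta>. k \<in> {1, 2, 3} \<Longrightarrow> (k, \<zeta>) \<noteq> (i, \<epsilon>) \<Longrightarrow> s k \<zeta> \<in> cells X 2"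
    and side: "\<And>k \<zeta> j \<eta>. k \<in> {1, 2, 3} \<Longrightarrow> (k, \<zeta>) \<noteq> (i, \<epsilon>) \<Longrightarrow> j \<in> {1, 2} \<Longrightarrow>
      square_side X j \<eta> (s k \<zeta>) = cube_face E k \<zeta> \<eta> j"
    by metis
  have in3: "j \<in> {1, 2, 3} \<longleftrightarrow> 1 \<le> j \<and> j \<le> 3" for j :: nat by auto
  have meet: "cube_face E j \<eta> \<zeta> (k - 1) = cube_face E k \<zeta> \<eta> j" if "1 \<le> j" "j < k" "k \<le> 3" for j k \<eta> \<zeta>
  proof -
    have "j = 1 \<and> k = 2 \<or> j = 1 \<and> k = 3 \<or> j = 2 \<and> k = 3" using that by auto
    then show ?thesis by (auto simp: cube_face_def)
  qed
  have "s j \<eta> \<in> cells X (3 - 1)" if "1 \<le> j" "j \<le> 3" "(j, \<eta>) \<noteq> (i, \<epsilon>)" for j \<eta>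
    using s[of j \<eta>] that unfolding in3 by simp
  moreover have "face_of X (3 - 1) (k - 1) \<zeta> (s j \<eta>) = face_of X (3 - 1) j \<eta> (s k \<zeta>)"
    if jk: "1 \<le> j" "j < k" "k \<le> 3" and ne: "(j, \<eta>) \<noteq> (i, \<epsilon>)" "(k, \<zeta>) \<noteq> (i, \<epsilon>)" for j k \<eta> \<zeta>
  proof -
    have "k - 1 \<in> {1, 2}" "j \<in> {1, 2}" using jk by auto
    then have "square_side X (k - 1) \<zeta> (s j \<eta>) = square_side X j \<eta> (s k \<zeta>)"
      using side[of j \<eta> "k - 1" \<zeta>] side[of k \<zeta> j \<eta>] meet[OF jk] ne jk unfolding in3 by simp
    then show ?thesis by (simp add: square_side_def)
  qed
  moreover have "1 \<le> i" "i \<le> 3" using i by auto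
  ultimately obtain z where z: "z \<in> cells X 3"
    "\<And>j \<eta>. 1 \<le> j \<Longrightarrow> j \<le> 3 \<Longrightarrow> (j, \<eta>) \<noteq> (i, \<epsilon>) \<Longrightarrow> face_of X 3 j \<eta> z = s j \<eta>"
    using kan_complex_filler[OF kan, of i 3 \<epsilon> s] by blast
  define y where "y = face_of X 3 i \<epsilon> z"
  have y: "y \<in> cells X 2"
    using act_closed[OF box_face[of i 3]] z(1) i unfolding y_def in3 by simp
  \<comment> \<open>The side in direction \<open>j\<close> of the new face lies on the given face in
    direction \<open>j\<close> if \<open>j < i\<close>, and in direction \<open>j + 1\<close>
    otherwise, since the new face has lost coordinate \<open>i\<close>.\<close>
  have "square_side X j \<eta> y = cube_face E i \<epsilon> \<eta> j" if j: "j \<in> {1, 2}" for j \<eta>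
  proof (cases "j < i")
    case True
    then have ij: "i - 1 \<in> {1, 2}" "j \<in> {1, 2, 3}" "i \<le> 3" "1 \<le> j" "j \<le> 3" "j \<noteq> i" using i j by auto
    have "face_of X (3 - 1) j \<eta> y = face_of X (3 - 1) (i - 1) \<epsilon> (s j \<eta>)"
      using face_of_face_of[OF cubical_set_axioms z(1) ij(4) True ij(3)] z(2)[OF ij(4,5)] ij(6)
      unfolding y_def by simp
    then have "square_side X j \<eta> y = square_side X (i - 1) \<epsilon> (s j \<eta>)"
      by (simp add: square_side_def)
    also have "\<dots> = cube_face E i \<epsilon> \<eta> j"
      using side[OF ij(2) _ ij(1)] meet[OF ij(4) True ij(3)] ij(6) by simp
    finally show ?thesis .
  next
    case False
    then have ij: "i \<in> {1, 2}" "Suc j \<in> {1, 2, 3}" "1 \<le> Suc j" "Suc j \<le> 3" "Suc j \<noteq> i" "1 \<le> i" "i < Suc j"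
      using i j by auto
    have "face_of X (3 - 1) j \<eta> y = face_of X (3 - 1) i \<epsilon> (s (Suc j) \<eta>)"
      using face_of_face_of[OF cubical_set_axioms z(1) ij(6,7,4)] z(2)[OF ij(3,4)] ij(5)
      unfolding y_def by simp
    then have "square_side X j \<eta> y = square_side X i \<epsilon> (s (Suc j) \<eta>)"
      by (simp add: square_side_def)
    also have "\<dots> = cube_face E i \<epsilon> \<eta> j"
      using side[OF ij(2) _ ij(1)] meet[OF ij(6,7,4)] ij(5) by simp
    finally show ?thesis .
  qed
  with y show ?thesis unfolding square_def by (intro bexI[of _ y]) simp_all
qed

end

section \<open>Loops\<close>

definition loops :: "'a cubical \<Rightarrow> 'a \<Rightarrow> 'a set" where
  "loops X x = {u \<in> cells X 1. \<forall>\<epsilon>. edge_end X \<epsilon> u = x}"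

text \<open>The loop coordinate is the first one, so direction 1 of the loop space is direction 2 of
  the original cubical set.\<close>

lemma id_times_face: "id_times 0 (face 1 1 \<epsilon>) = face 2 2 \<epsilon>"
proof (rule ext)
  fix v
  show "id_times 0 (face 1 1 \<epsilon>) v = face 2 2 \<epsilon> v"
  proof (cases "v \<in> vertices 1")
    case True
    then obtain a where "v = [a]" by (auto simp: vertices_1)
    then show ?thesis by (simp add: id_times_def face_def vertices_def)
  qed (simp add: id_times_def face_def)
qed

context cubical_set
begin

lemma square_ends:
  assumes "square X l t b r"
  shows "l \<in> cells X 1" "t \<in> cells X 1" "b \<in> cells X 1" "r \<in> cells X 1"
    "edge_end X False l = edge_end X False b" "edge_end X True l = edge_end X False t"
    "edge_end X True b = edge_end X False r" "edge_end X True t = edge_end X True r"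
  using assms square_side_closed edge_end_square_side unfolding square_def by auto

lemma loop_space_cells_0: "x \<in> cells X 0 \<Longrightarrow> cells (loop_space X x) 0 = loops X x"
  unfolding loop_space_def loops_def by (auto simp: const_cube_0 edge_end_def all_bool_eq)

text \<open>The conditions on the loop coordinate make left and right sides constant; the ends of
  the edge are bottom and top. Hence a homotopy from \<open>u\<close> to \<open>v\<close> is the
  relation \<open>1 v = u 1\<close>.\<close>

lemma loop_space_edge_iff:
  assumes "x \<in> cells X 0"
  shows "(\<exists>z\<in>cells (loop_space X x) 1. u = face_of (loop_space X x) 1 1 False z \<and>
      v = face_of (loop_space X x) 1 1 True z) \<longleftrightarrow>
    square X (const_loop X x) v u (const_loop X x)"
  unfolding loop_space_def square_def square_side_def
  by (auto simp: id_times_face const_cube_1)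

lemma const_loop_in_loops: "x \<in> cells X 0 \<Longrightarrow> const_loop X x \<in> loops X x"
  by (simp add: loops_def const_loop_closed edge_end_const_loop)

lemma degenerate_loop_squares:
  assumes "u \<in> loops X x"
  shows "square X u (const_loop X x) (const_loop X x) u"
    and "square X (const_loop X x) u u (const_loop X x)"
    and "square X u (const_loop X x) u (const_loop X x)"
  using degenerate_squares[of u] assms by (auto simp: loops_def)

end

context kan
begin

text \<open>The letters \<open>a\<close>, \<open>b\<close>, \<open>c\<close> are the edges in
  directions 1, 2, 3, and their digits are the other two coordinates in increasing order of
  direction. The digits in the name of a law are direction and endpoint of the face that it
  produces.\<close>

lemma cube_laws:
  shows cube_law_20: "square X c00 b01 b00 c01 \<Longrightarrow> square X c10 b11 b10 c11 \<Longrightarrow>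
      square X c01 a11 a10 c11 \<Longrightarrow> square X b00 a10 a00 b10 \<Longrightarrow> square X b01 a11 a01 b11 \<Longrightarrow>
      square X c00 a01 a00 c10"
    and cube_law_30: "square X c00 b01 b00 c01 \<Longrightarrow> square X c10 b11 b10 c11 \<Longrightarrow>
      square X c00 a01 a00 c10 \<Longrightarrow> square X c01 a11 a10 c11 \<Longrightarrow> square X b01 a11 a01 b11 \<Longrightarrow>
      square X b00 a10 a00 b10"
    and cube_law_31: "square X c00 b01 b00 c01 \<Longrightarrow> square X c10 b11 b10 c11 \<Longrightarrow>
      square X c00 a01 a00 c10 \<Longrightarrow> square X c01 a11 a10 c11 \<Longrightarrow> square X b00 a10 a00 b10 \<Longrightarrow>
      square X b01 a11 a01 b11"
proof -
  define E where "E k \<eta> \<zeta> =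
    (if k = (1::nat) then if \<eta> then if \<zeta> then a11 else a10 else if \<zeta> then a01 else a00
     else if k = 2 then if \<eta> then if \<zeta> then b11 else b10 else if \<zeta> then b01 else b00
     else if \<eta> then if \<zeta> then c11 else c10 else if \<zeta> then c01 else c00)" for k \<eta> \<zeta>
  define F where "F k \<zeta> \<longleftrightarrow> square X (cube_face E k \<zeta> False 1) (cube_face E k \<zeta> True 2)
    (cube_face E k \<zeta> False 2) (cube_face E k \<zeta> True 1)" for k \<zeta>
  have F: "F 1 False \<longleftrightarrow> square X c00 b01 b00 c01" "F 1 True \<longleftrightarrow> square X c10 b11 b10 c11"
    "F 2 False \<longleftrightarrow> square X c00 a01 a00 c10" "F 2 True \<longleftrightarrow> square X c01 a11 a10 c11"
    "F 3 False \<longleftrightarrow> square X b00 a10 a00 b10" "F 3 True \<longleftrightarrow> square X b01 a11 a01 b11"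
    by (simp_all add: F_def cube_face_def E_def)
  have law: "F i \<epsilon>" if "i \<in> {1, 2, 3}" "\<forall>\<zeta>. (1, \<zeta>) \<noteq> (i, \<epsilon>) \<longrightarrow> F 1 \<zeta>"
    "\<forall>\<zeta>. (2, \<zeta>) \<noteq> (i, \<epsilon>) \<longrightarrow> F 2 \<zeta>" "\<forall>\<zeta>. (3, \<zeta>) \<noteq> (i, \<epsilon>) \<longrightarrow> F 3 \<zeta>" for i \<epsilon>
    using cube_law[of i \<epsilon> E] that unfolding F_def by blast
  show "square X c00 b01 b00 c01 \<Longrightarrow> square X c10 b11 b10 c11 \<Longrightarrow>
      square X c01 a11 a10 c11 \<Longrightarrow> square X b00 a10 a00 b10 \<Longrightarrow> square X b01 a11 a01 b11 \<Longrightarrow>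
      square X c00 a01 a00 c10"
    unfolding F [symmetric] by (rule law) (simp_all add: all_bool_eq)
  show "square X c00 b01 b00 c01 \<Longrightarrow> square X c10 b11 b10 c11 \<Longrightarrow>
      square X c00 a01 a00 c10 \<Longrightarrow> square X c01 a11 a10 c11 \<Longrightarrow> square X b01 a11 a01 b11 \<Longrightarrow>
      square X b00 a10 a00 b10"
    unfolding F [symmetric] by (rule law) (simp_all add: all_bool_eq)
  show "square X c00 b01 b00 c01 \<Longrightarrow> square X c10 b11 b10 c11 \<Longrightarrow>
      square X c00 a01 a00 c10 \<Longrightarrow> square X c01 a11 a10 c11 \<Longrightarrow> square X b00 a10 a00 b10 \<Longrightarrow>
      square X b01 a11 a01 b11"
    unfolding F [symmetric] by (rule law) (simp_all add: all_bool_eq)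
qed

end

section \<open>Homotopy of loops and the group structure on their classes\<close>

locale pointed_cubical = cubical_set X for X :: "'a cubical" +
  fixes x :: 'a
  assumes base: "x \<in> cells X 0"

locale pointed_kan = kan X + pointed_cubical X x for X :: "'a cubical" and x :: 'a
begin

abbreviation unit_loop :: 'a ("\<e>") where "\<e> \<equiv> const_loop X x"

abbreviation homotopic :: "'a \<Rightarrow> 'a \<Rightarrow> bool" (infix "\<simeq>" 50) where
  "u \<simeq> v \<equiv> square X \<e> v u \<e>"

abbreviation cls :: "'a \<Rightarrow> 'a set" where "cls \<equiv> loop_class X x"

lemma unit_loop: "\<e> \<in> loops X x" by (rule const_loop_in_loops[OF base])

lemma unit_square: "square X \<e> \<e> \<e> \<e>" using degenerate_loop_squares[OF unit_loop] by simp

lemma loops_of_square: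
  assumes "square X l t b r"
  shows "l \<in> loops X x \<Longrightarrow> r \<in> loops X x \<Longrightarrow> b \<in> loops X x"
    "l \<in> loops X x \<Longrightarrow> r \<in> loops X x \<Longrightarrow> t \<in> loops X x"
    "b \<in> loops X x \<Longrightarrow> t \<in> loops X x \<Longrightarrow> l \<in> loops X x"
    "b \<in> loops X x \<Longrightarrow> t \<in> loops X x \<Longrightarrow> r \<in> loops X x"
  using square_ends[OF assms] by (auto simp: loops_def all_bool_eq)

text \<open>A cube with the given square at one end and the new one at the other: its lateral faces
  are the four homotopies, and its edges between the two ends are constant.\<close>

lemma square_cong:
  assumes "square X l t b r" "l \<simeq> l'" "t \<simeq> t'" "b \<simeq> b'" "r \<simeq> r'"
  shows "square X l' t' b' r'"
  by (rule cube_law_31[OF assms(2,5,4,3,1)])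

lemma homotopic_refl: "u \<in> loops X x \<Longrightarrow> u \<simeq> u"
  by (rule degenerate_loop_squares)

lemma homotopic_loops: "u \<simeq> v \<Longrightarrow> u \<in> loops X x \<and> v \<in> loops X x"
  using loops_of_square(1,2) unit_loop by blast

text \<open>Replacing the bottom of the degenerate homotopy from \<open>u\<close> to itself by
  \<open>v\<close> reverses the homotopy.\<close>

lemma homotopic_sym: "u \<simeq> v \<Longrightarrow> v \<simeq> u"
  using square_cong[of \<e> u u \<e> \<e> u v \<e>] homotopic_loops homotopic_refl unit_loop by blast

lemma homotopic_trans: "u \<simeq> v \<Longrightarrow> v \<simeq> w \<Longrightarrow> u \<simeq> w"
  using square_cong[of \<e> v u \<e> \<e> w u \<e>] homotopic_loops homotopic_refl unit_loop by blast

lemma pi0_rel_loops: "pi0_rel (loop_space X x) = {(u, v). u \<simeq> v}"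
proof -
  have "equivclp (\<lambda>u v. u \<simeq> v) u v \<Longrightarrow> u \<in> loops X x \<Longrightarrow> u \<simeq> v" for u v
    by (induction rule: equivclp_induct) (use homotopic_refl homotopic_sym homotopic_trans in blast)+
  moreover have "u \<simeq> v \<Longrightarrow> equivclp (\<lambda>u v. u \<simeq> v) u v" for u v
    by (rule r_into_equivclp)
  ultimately show ?thesis
    unfolding pi0_rel_def loop_space_edge_iff[OF base] loop_space_cells_0[OF base]
    using homotopic_loops by blast
qed

lemma cls_eq: "u \<simeq> v \<Longrightarrow> cls u = cls v"
  unfolding pi0_class_def pi0_rel_loops using homotopic_sym homotopic_trans by blast

lemma mem_cls: "u \<in> cls v \<longleftrightarrow> v \<simeq> u"
  unfolding pi0_class_def pi0_rel_loops by simp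

lemma carrier_pi1: "carrier (pi1 X x) = cls ` loops X x"
  unfolding pi1_def pi0_def quotient_def loop_space_cells_0[OF base] pi0_class_def by auto

lemma one_pi1: "\<one>\<^bsub>pi1 X x\<^esub> = cls \<e>"
  by (simp add: pi1_def)

text \<open>The two squares are opposite faces of a cube whose other given faces are the trivial
  homotopies of \<open>u\<close> and of \<open>v\<close> and a constant square; the sixth face is
  the homotopy.\<close>

lemma product_unique:
  assumes "square X u v w \<e>" "square X u v w' \<e>" "u \<in> loops X x"
  shows "w \<simeq> w'"
proof -
  have "v \<in> loops X x" using loops_of_square(2)[OF assms(1)] assms(3) unit_loop by blast
  then show ?thesis
    using cube_law_20[OF _ unit_square _ assms(1,2)] homotopic_refl assms(3) by blast
qed

lemma mult_pi1:
  assumes "square X u v w \<e>" "u \<in> loops X x"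
  shows "cls u \<otimes>\<^bsub>pi1 X x\<^esub> cls v = cls w"
proof -
  have w: "w \<in> loops X x" using loops_of_square(1)[OF assms(1)] assms(2) unit_loop by blast
  have v: "v \<in> loops X x" using loops_of_square(2)[OF assms(1)] assms(2) unit_loop by blast
  \<comment> \<open>The set under \<open>the_elem\<close> is a singleton: \<open>square_cong\<close>
    moves the given square to arbitrary representatives, and \<open>product_unique\<close> compares
    the products.\<close>
  have "{cls (face_of X 2 2 False s) | s u' v'. u' \<in> cls u \<and> v' \<in> cls v \<and>
      concatenation_square X x u' v' s} = {cls w}" (is "?L = _")
  proof
    show "?L \<subseteq> {cls w}"
    proof clarify
      fix s u' v' assume uv: "u' \<in> cls u" "v' \<in> cls v" and s: "concatenation_square X x u' v' s"
      have "square X u' v' (face_of X 2 2 False s) \<e>"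
        using s by (auto simp: concatenation_square_def square_def square_side_def)
      moreover have "square X u' v' w \<e>"
        using square_cong[OF assms(1)] uv homotopic_refl w unit_loop unfolding mem_cls by blast
      ultimately show "cls (face_of X 2 2 False s) = cls w"
        using product_unique uv homotopic_loops cls_eq unfolding mem_cls by blast
    qed
    obtain s where "concatenation_square X x u v s" "face_of X 2 2 False s = w"
      using assms by (auto simp: concatenation_square_def square_def square_side_def)
    then show "{cls w} \<subseteq> ?L"
      using assms v homotopic_refl unfolding mem_cls by blast
  qed
  then show ?thesis unfolding pi1_def by simp
qed

lemma product_exists:
  assumes "u \<in> loops X x" "v \<in> loops X x"
  obtains w where "square X u v w \<e>" "w \<in> loops X x"
  using square_bottom_filler[of u v \<e>] assms unit_loop loops_of_square(1) by (auto simp: loops_def)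

text \<open>The first square states \<open>p = u v\<close>, with the product on the left side rather
  than at the bottom. In this position it is adjacent, in a cube, to the squares for
  \<open>p w = q\<close> and \<open>v w = s\<close>, and the remaining face reads
  \<open>u s = q\<close>.\<close>

lemma square_assoc:
  assumes "square X p \<e> u v" "square X v w s \<e>" "square X p w q \<e>" "v \<in> loops X x"
  shows "square X u s q \<e>"
proof -
  have "w \<in> loops X x" using loops_of_square(2)[OF assms(2)] assms(4) unit_loop by blast
  then show ?thesis
    using cube_law_30[OF assms(1) unit_square assms(3,2)] homotopic_refl by blast
qed

text \<open>With \<open>w = l t\<close> presented as a square, the relation \<open>l t = b r\<close>
  says the same as \<open>w = b r\<close>. The cube joining the two is closed by the connection
  squares of \<open>t\<close> and \<open>r\<close>.\<close>

lemma square_shift: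
  assumes "square X w \<e> l t" "t \<in> loops X x"
  shows "square X w \<e> b r \<Longrightarrow> r \<in> loops X x \<Longrightarrow> square X l t b r"
    and "square X l t b r \<Longrightarrow> r \<in> loops X x \<Longrightarrow> square X w \<e> b r"
proof -
  have t: "square X t \<e> t \<e>" using degenerate_loop_squares(3) assms(2) by blast
  show "square X l t b r" if "square X w \<e> b r" "r \<in> loops X x"
    by (rule cube_law_30[OF assms(1) degenerate_loop_squares(3)[OF that(2)] that(1) t unit_square])
  show "square X w \<e> b r" if "square X l t b r" "r \<in> loops X x"
    by (rule cube_law_20[OF assms(1) degenerate_loop_squares(3)[OF that(2)] t that(1) unit_square])
qed

text \<open>In place of a reflection, one direction shifts the connection square of
  \<open>w\<close>. For the other, a filler \<open>w'\<close> is produced on the left and found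
  homotopic to \<open>w\<close> by shifting back.\<close>

lemma square_left_iff_bottom:
  assumes u: "u \<in> loops X x" and v: "v \<in> loops X x"
  shows "square X u v w \<e> \<longleftrightarrow> square X w \<e> u v"
proof
  assume *: "square X w \<e> u v"
  then have "w \<in> loops X x" using loops_of_square(3) u unit_loop by blast
  then show "square X u v w \<e>"
    using square_shift(1)[OF * v] degenerate_loop_squares(3) unit_loop by blast
next
  assume *: "square X u v w \<e>"
  obtain w' where w': "square X w' \<e> u v"
    using square_left_filler[of \<e> u v] u v unit_loop by (auto simp: loops_def)
  then have "w' \<in> loops X x" using loops_of_square(3) u unit_loop by blast
  moreover have "square X w' \<e> w \<e>" using square_shift(2)[OF w' v *] unit_loop by blast
  ultimately have "w' \<simeq> w"
    using product_unique degenerate_loop_squares(3) by blast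
  then show "square X w \<e> u v"
    using square_cong[OF w'] homotopic_refl u v unit_loop by blast
qed

lemma group_pi1: "group (pi1 X x)"
proof (rule groupI)
  show "A \<otimes>\<^bsub>pi1 X x\<^esub> B \<in> carrier (pi1 X x)"
    if AB: "A \<in> carrier (pi1 X x)" "B \<in> carrier (pi1 X x)" for A B
  proof -
    obtain u v where uv: "A = cls u" "B = cls v" "u \<in> loops X x" "v \<in> loops X x"
      using AB unfolding carrier_pi1 by blast
    obtain w where "square X u v w \<e>" "w \<in> loops X x" using product_exists uv(3,4) by blast
    with uv show ?thesis by (auto simp: mult_pi1 carrier_pi1)
  qed
  show "\<one>\<^bsub>pi1 X x\<^esub> \<in> carrier (pi1 X x)"
    unfolding one_pi1 carrier_pi1 using unit_loop by blast
  show "\<one>\<^bsub>pi1 X x\<^esub> \<otimes>\<^bsub>pi1 X x\<^esub> A = A" if "A \<in> carrier (pi1 X x)" for A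
    using that mult_pi1[OF degenerate_loop_squares(2) unit_loop] unfolding one_pi1 carrier_pi1 by blast
  show "A \<otimes>\<^bsub>pi1 X x\<^esub> B \<otimes>\<^bsub>pi1 X x\<^esub> C = A \<otimes>\<^bsub>pi1 X x\<^esub> (B \<otimes>\<^bsub>pi1 X x\<^esub> C)"
    if ABC: "A \<in> carrier (pi1 X x)" "B \<in> carrier (pi1 X x)" "C \<in> carrier (pi1 X x)" for A B C
  proof -
    obtain u v w where uvw: "A = cls u" "B = cls v" "C = cls w" "u \<in> loops X x" "v \<in> loops X x" "w \<in> loops X x"
      using ABC unfolding carrier_pi1 by blast
    obtain p where p: "square X u v p \<e>" "p \<in> loops X x" using product_exists uvw(4-6) by blast
    obtain q where q: "square X p w q \<e>" "q \<in> loops X x" using product_exists p(2) uvw(6) by blast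
    obtain s where s: "square X v w s \<e>" "s \<in> loops X x" using product_exists uvw(4-6) by blast
    \<comment> \<open>Here the product \<open>p\<close> of \<open>u\<close> and \<open>v\<close>
      passes from the bottom of its square to the left.\<close>
    have "square X u s q \<e>"
      using square_assoc[OF _ s(1) q(1) uvw(5)] p(1) square_left_iff_bottom[OF uvw(4,5)] by blast
    with p q s uvw show ?thesis by (simp add: mult_pi1)
  qed
  show "\<exists>B\<in>carrier (pi1 X x). B \<otimes>\<^bsub>pi1 X x\<^esub> A = \<one>\<^bsub>pi1 X x\<^esub>" if A: "A \<in> carrier (pi1 X x)" for A
  proof -
    obtain u where u: "A = cls u" "u \<in> loops X x" using A unfolding carrier_pi1 by blast
    \<comment> \<open>A left inverse is the missing left side of an open square with top
      \<open>u\<close> and constant bottom and right sides.\<close>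
    obtain v where v: "square X v u \<e> \<e>"
      using square_left_filler[of u \<e> \<e>] u unit_loop by (auto simp: loops_def)
    then have "v \<in> loops X x" using loops_of_square(3) u unit_loop by blast
    with mult_pi1[OF v] u show ?thesis unfolding carrier_pi1 one_pi1 by blast
  qed
qed

text \<open>The product \<open>w\<close> of \<open>l\<close> and \<open>t\<close> is moved to the
  left, shifted to \<open>b\<close> and \<open>r\<close>, and moved back to the bottom. In this way
  every square of loops becomes an equation in the group.\<close>

lemma mult_square:
  assumes Q: "square X l t b r" and "l \<in> loops X x" "t \<in> loops X x" "b \<in> loops X x" "r \<in> loops X x"
  shows "cls l \<otimes>\<^bsub>pi1 X x\<^esub> cls t = cls b \<otimes>\<^bsub>pi1 X x\<^esub> cls r"
proof -
  obtain w where w: "square X l t w \<e>" using product_exists assms by blast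
  then have "square X w \<e> l t" using square_left_iff_bottom assms by blast
  then have "square X w \<e> b r" using square_shift(2) Q assms by blast
  then have "square X b r w \<e>" using square_left_iff_bottom assms by blast
  with w show ?thesis using assms by (simp add: mult_pi1)
qed

end

section \<open>Straightening edges to loops\<close>

locale connected_kan = pointed_kan X x for X :: "'a cubical" and x :: 'a +
  assumes connected: "zero_connected X"
begin

text \<open>Connectedness only supplies a zigzag of edges; fillers of open squares shorten it to a
  single edge, one step at a time.\<close>

lemma path_exists:
  assumes "v \<in> cells X 0"
  shows "\<exists>p\<in>cells X 1. edge_end X False p = x \<and> edge_end X True p = v"
proof -
  let ?R = "\<lambda>a b. \<exists>e\<in>cells X 1. a = face_of X 1 1 False e \<and> b = face_of X 1 1 True e"
  have R: "?R = (\<lambda>a b. \<exists>e\<in>cells X 1. a = edge_end X False e \<and> b = edge_end X True e)"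
    by (simp add: edge_end_def)
  obtain C where C: "pi0 X = {C}"
    using connected by (auto simp: zero_connected_def is_singleton_def)
  have "pi0_rel X `` {a} = C" if "a \<in> cells X 0" for a
    using C that quotientI[of a "cells X 0" "pi0_rel X"] by (auto simp: pi0_def)
  then have "pi0_rel X `` {x} = pi0_rel X `` {v}" using base assms by simp
  moreover have "v \<in> pi0_rel X `` {v}" using assms by (simp add: pi0_rel_def)
  ultimately have "(x, v) \<in> pi0_rel X" by blast
  then have "equivclp ?R x v" unfolding pi0_rel_def by blast
  moreover note x0 = base
  ultimately show ?thesis
    unfolding R
  proof (induction rule: equivclp_induct)
    case base
    show ?case
      using const_loop_closed[OF x0] edge_end_const_loop[OF x0] by blast
  next
    case (step y z)
    then obtain p where p: "p \<in> cells X 1" "edge_end X False p = x" "edge_end X True p = y" by blast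
    from step(2) show ?case
    proof
      assume "\<exists>e\<in>cells X 1. y = edge_end X False e \<and> z = edge_end X True e"
      then obtain e where e: "e \<in> cells X 1" "y = edge_end X False e" "z = edge_end X True e" by blast
      then have z: "z \<in> cells X 0" using edge_end_closed by blast
      \<comment> \<open>An edge traversed forwards is appended: \<open>q\<close> is
        \<open>p e\<close>.\<close>
      obtain q where "square X p e q (const_loop X z)"
        by (rule square_bottom_filler[of p e "const_loop X z"])
          (use p e z const_loop_closed edge_end_const_loop in auto)
      from square_ends[OF this] show ?thesis using p edge_end_const_loop z by auto
    next
      assume "\<exists>e\<in>cells X 1. z = edge_end X False e \<and> y = edge_end X True e"
      then obtain e where e: "e \<in> cells X 1" "z = edge_end X False e" "y = edge_end X True e" by blast
      then have y: "y \<in> cells X 0" using edge_end_closed by blast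
      \<comment> \<open>An edge traversed backwards is divided off: \<open>q\<close> solves
        \<open>q e = p\<close>.\<close>
      obtain q where "square X q e p (const_loop X y)"
        by (rule square_left_filler[of e p "const_loop X y"])
          (use p e y const_loop_closed edge_end_const_loop in auto)
      from square_ends(1,5,6)[OF this] have "q \<in> cells X 1" "edge_end X False q = x" "edge_end X True q = z"
        unfolding p(2) e(2) by simp_all
      then show ?thesis by blast
    qed
  qed
qed

text \<open>The value at \<open>x\<close> is prescribed: \<open>x\<close> is zero in the reduced
  \<open>0\<close>-chains, so the class of its path must be trivial, and with the constant path a
  loop is a straightening of itself.\<close>

definition path :: "'a \<Rightarrow> 'a" where
  "path v = (if v = x then \<e> else SOME p. p \<in> cells X 1 \<and> edge_end X False p = x \<and> edge_end X True p = v)"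

lemma path_base: "path x = \<e>"
  by (simp add: path_def)

lemma path:
  assumes "v \<in> cells X 0"
  shows "path v \<in> cells X 1" "edge_end X False (path v) = x" "edge_end X True (path v) = v"
proof -
  have "path v \<in> cells X 1 \<and> edge_end X False (path v) = x \<and> edge_end X True (path v) = v"
  proof (cases "v = x")
    case True
    then show ?thesis using unit_loop by (simp add: path_def loops_def)
  next
    case False
    then show ?thesis
      using someI_ex[of "\<lambda>p. p \<in> cells X 1 \<and> edge_end X False p = x \<and> edge_end X True p = v"]
        path_exists[OF assms] by (auto simp: path_def)
  qed
  then show "path v \<in> cells X 1" "edge_end X False (path v) = x" "edge_end X True (path v) = v" by auto
qed

text \<open>Any bottom side of such a square will do, as \<open>straighten_unique\<close> makes it
  unique up to homotopy. It stands for the path to the start, then \<open>e\<close>, then the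
  reverse of the path to the end.\<close>

definition straighten :: "'a \<Rightarrow> 'a" where
  "straighten e = (SOME l. square X (path (edge_end X False e)) e l (path (edge_end X True e)))"

lemma straighten_square:
  assumes "e \<in> cells X 1"
  shows "square X (path (edge_end X False e)) e (straighten e) (path (edge_end X True e))"
proof -
  have "edge_end X \<epsilon> e \<in> cells X 0" for \<epsilon> using assms edge_end_closed by blast
  then obtain l where "square X (path (edge_end X False e)) e l (path (edge_end X True e))"
    using square_bottom_filler[of "path (edge_end X False e)" e "path (edge_end X True e)"] path assms
    by metis
  then show ?thesis unfolding straighten_def by (rule someI)
qed

lemma straighten_in_loops: "e \<in> cells X 1 \<Longrightarrow> straighten e \<in> loops X x"
  using square_ends[OF straighten_square, of e] path edge_end_closed by (auto simp: loops_def all_bool_eq)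

text \<open>The square is one end of a cube whose edges in direction 3 are the chosen paths to its
  corners; the straightening squares are the lateral faces. Arbitrary straightenings are allowed, so
  that constant edges can be given the constant loop.\<close>

lemma straighten_square_to:
  assumes sq: "square X l t b r"
    and "square X (path (edge_end X False l)) l l' (path (edge_end X True l))"
    and "square X (path (edge_end X False t)) t t' (path (edge_end X True t))"
    and "square X (path (edge_end X False b)) b b' (path (edge_end X True b))"
    and "square X (path (edge_end X False r)) r r' (path (edge_end X True r))"
  shows "square X l' t' b' r'"
  using cube_law_30[OF assms(2) _ _ _ sq] assms(3-5) square_ends(5-8)[OF sq] by simp

text \<open>Straightening the degenerate square between two copies of \<open>e\<close>, by
  \<open>l\<close> on one copy and by \<open>l'\<close> on the other, gives a homotopy.\<close>

lemma straighten_unique: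
  assumes e: "e \<in> cells X 1"
    and l: "square X (path (edge_end X False e)) e l (path (edge_end X True e))"
    and l': "square X (path (edge_end X False e)) e l' (path (edge_end X True e))"
  shows "l \<simeq> l'"
proof -
  \<comment> \<open>The degenerate square on the path to \<open>v\<close> straightens the constant
    edge at \<open>v\<close> to the constant loop.\<close>
  have c: "square X (path (edge_end X \<epsilon> c)) c \<e> (path (edge_end X \<zeta> c))"
    if "c = const_loop X v" "v \<in> cells X 0" for c v \<epsilon> \<zeta>
    using degenerate_squares(1)[OF path(1)[OF that(2)]] that path[OF that(2)] by (simp add: edge_end_const_loop)
  show ?thesis
    by (rule straighten_square_to[OF degenerate_squares(2)[OF e] c l' l c])
      (use e edge_end_closed in auto)
qed

lemma straighten_const: "v \<in> cells X 0 \<Longrightarrow> cls (straighten (const_loop X v)) = cls \<e>"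
proof -
  assume v: "v \<in> cells X 0"
  have "square X (path v) (const_loop X v) \<e> (path v)"
    using degenerate_squares(1)[OF path(1)[OF v]] path[OF v] by simp
  then show ?thesis
    using straighten_unique[OF const_loop_closed[OF v] straighten_square[OF const_loop_closed[OF v]]]
    by (simp add: edge_end_const_loop v cls_eq)
qed

lemma straighten_loop:
  assumes "u \<in> loops X x"
  shows "cls (straighten u) = cls u"
proof -
  have u: "u \<in> cells X 1" "edge_end X \<epsilon> u = x" for \<epsilon> using assms by (auto simp: loops_def)
  have "square X (path (edge_end X False u)) u u (path (edge_end X True u))"
    unfolding u(2) path_base by (rule homotopic_refl[OF assms])
  then show ?thesis by (rule cls_eq[OF straighten_unique[OF u(1) straighten_square[OF u(1)]]])
qed

lemma straighten_mult:
  assumes "square X l t b r"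
  shows "cls (straighten l) \<otimes>\<^bsub>pi1 X x\<^esub> cls (straighten t) =
    cls (straighten b) \<otimes>\<^bsub>pi1 X x\<^esub> cls (straighten r)"
proof -
  note ends = square_ends[OF assms]
  note s = straighten_square[OF ends(1)] straighten_square[OF ends(2)]
    straighten_square[OF ends(3)] straighten_square[OF ends(4)]
  show ?thesis
    by (rule mult_square[OF straighten_square_to[OF assms s]]) (rule straighten_in_loops, rule ends)+
qed

end

section \<open>Maps of quotients\<close>

text \<open>Images of two representatives differ by some \<open>f n\<close> with \<open>n\<close> in
  \<open>N\<close>, which lies in \<open>M\<close>; so the set under \<open>the_elem\<close> is a
  singleton.\<close>

lemma quotient_map_coset:
  assumes f: "group_hom G H f" and N: "N \<lhd> G" and M: "M \<lhd> H" and fN: "f ` N \<subseteq> M" and c: "c \<in> carrier G"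
  shows "quotient_map H M f (N #>\<^bsub>G\<^esub> c) = M #>\<^bsub>H\<^esub> f c"
proof -
  interpret group_hom G H f by fact
  interpret N: normal N G by fact
  interpret M: normal M H by fact
  have "M #>\<^bsub>H\<^esub> f (n \<otimes>\<^bsub>G\<^esub> c) = M #>\<^bsub>H\<^esub> f c" if n: "n \<in> N" for n
  proof -
    have "f n \<in> M" using fN n by blast
    moreover have "f (n \<otimes>\<^bsub>G\<^esub> c) = f n \<otimes>\<^bsub>H\<^esub> f c" using n c by simp
    ultimately show ?thesis
      using c M.subset by (simp add: H.coset_mult_assoc [symmetric] H.coset_join2 M.is_subgroup)
  qed
  moreover have "c \<in> N #>\<^bsub>G\<^esub> c" using c N.is_subgroup by (rule G.rcos_self)
  ultimately have "(\<lambda>c. M #>\<^bsub>H\<^esub> f c) ` (N #>\<^bsub>G\<^esub> c) = {M #>\<^bsub>H\<^esub> f c}"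
    by (auto simp: r_coset_def)
  then show ?thesis by (simp add: quotient_map_def)
qed

lemma quotient_map_hom:
  assumes f: "group_hom G H f" and N: "N \<lhd> G" and M: "M \<lhd> H" and fN: "f ` N \<subseteq> M"
  shows "quotient_map H M f \<in> hom (G Mod N) (H Mod M)"
proof (rule homI)
  interpret group_hom G H f by fact
  interpret N: normal N G by fact
  interpret M: normal M H by fact
  note q = quotient_map_coset[OF f N M fN]
  show "quotient_map H M f A \<in> carrier (H Mod M)" if "A \<in> carrier (G Mod N)" for A
    using that by (auto simp: carrier_FactGroup q)
  show "quotient_map H M f (A \<otimes>\<^bsub>G Mod N\<^esub> B) = quotient_map H M f A \<otimes>\<^bsub>H Mod M\<^esub> quotient_map H M f B"
    if "A \<in> carrier (G Mod N)" "B \<in> carrier (G Mod N)" for A B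
    using that by (auto simp: carrier_FactGroup q N.rcos_sum M.rcos_sum)
qed

section \<open>The first homology group of a cubical abelian group\<close>

context cubical_abelian_group
begin

lemma cells_underlying: "cells (underlying A) n = carrier (grp A n)"
  by (simp add: underlying_def)

lemma gact_group_hom: "box_hom m n \<phi> \<Longrightarrow> group_hom (grp A n) (grp A m) (act (underlying A) m n \<phi>)"
  using gact_hom grp_comm_group
  by (simp add: group_hom_def group_hom_axioms_def underlying_def comm_group.axioms(2))

lemma edge_end_hom: "group_hom (grp A 1) (grp A 0) (edge_end (underlying A) \<epsilon>)"
  using gact_group_hom[OF box_face[of 1 1 \<epsilon>]] by (simp add: edge_end_def[abs_def])

lemma square_side_hom: "i \<in> {1, 2} \<Longrightarrow> group_hom (grp A 2) (grp A 1) (square_side (underlying A) i \<epsilon>)"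
  using gact_group_hom[OF box_face[of i 2 \<epsilon>]] by (auto simp: square_side_def[abs_def])

lemma const_loop_hom: "group_hom (grp A 0) (grp A 1) (const_loop (underlying A))"
  using gact_group_hom[OF box_degen[of 1 1]] by (simp add: const_loop_def[abs_def])

abbreviation start :: "'a \<Rightarrow> 'a" where "start \<equiv> edge_end (underlying A) False"
abbreviation finish :: "'a \<Rightarrow> 'a" where "finish \<equiv> edge_end (underlying A) True"

lemma cub_diff_1:
  assumes "a \<in> carrier (grp A 1)"
  shows "cub_diff A 1 a = inv\<^bsub>grp A 0\<^esub> start a \<otimes>\<^bsub>grp A 0\<^esub> finish a"
proof -
  interpret comm_group "grp A 0" by (rule grp_comm_group)
  have c: "gact A 0 1 (face 1 1 \<epsilon>) a \<in> carrier (grp A 0)" for \<epsilon>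
    using group_hom.hom_closed[OF edge_end_hom assms, of \<epsilon>] by (simp add: edge_end_def underlying_def)
  show ?thesis
    using c by (simp add: cub_diff_def UNIV_bool edge_end_def underlying_def int_pow_neg)
qed

lemma cub_diff_2:
  assumes "a \<in> carrier (grp A 2)"
  shows "cub_diff A 2 a =
    (inv\<^bsub>grp A 1\<^esub> square_side (underlying A) 1 False a \<otimes>\<^bsub>grp A 1\<^esub> square_side (underlying A) 1 True a) \<otimes>\<^bsub>grp A 1\<^esub>
    (square_side (underlying A) 2 False a \<otimes>\<^bsub>grp A 1\<^esub> inv\<^bsub>grp A 1\<^esub> square_side (underlying A) 2 True a)"
proof -
  interpret comm_group "grp A 1" by (rule grp_comm_group)
  have c: "gact A 1 2 (face 2 1 \<epsilon>) a \<in> carrier (grp A 1)" "gact A 1 2 (face 2 2 \<epsilon>) a \<in> carrier (grp A 1)" for \<epsilon>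
    using group_hom.hom_closed[OF square_side_hom assms, of 1 \<epsilon>] group_hom.hom_closed[OF square_side_hom assms, of 2 \<epsilon>]
    by (simp_all add: square_side_def underlying_def)
  have "{1..2::nat} = {1, 2}" by auto
  then show ?thesis
    using c by (simp add: cub_diff_def UNIV_bool square_side_def underlying_def int_pow_neg)
qed

lemma cub_diff_1_hom: "group_hom (grp A 1) (grp A 0) (cub_diff A 1)"
proof -
  interpret G: comm_group "grp A 0" by (rule grp_comm_group)
  interpret s: group_hom "grp A 1" "grp A 0" start by (rule edge_end_hom)
  interpret f: group_hom "grp A 1" "grp A 0" finish by (rule edge_end_hom)
  show ?thesis
    by unfold_locales (auto simp: hom_def cub_diff_1 G.inv_mult G.m_ac)
qed

lemma cub_diff_2_hom: "group_hom (grp A 2) (grp A 1) (cub_diff A 2)"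
proof -
  interpret G: comm_group "grp A 1" by (rule grp_comm_group)
  interpret s: group_hom "grp A 2" "grp A 1" "square_side (underlying A) 1 \<epsilon>" for \<epsilon> by (rule square_side_hom) simp
  interpret t: group_hom "grp A 2" "grp A 1" "square_side (underlying A) 2 \<epsilon>" for \<epsilon> by (rule square_side_hom) simp
  show ?thesis
    by unfold_locales (auto simp: hom_def cub_diff_2 G.inv_mult G.m_ac)
qed

section \<open>Degenerate chains and the Moore complex in low degrees\<close>

lemma degenerate_0: "degenerate A 0 = {\<one>\<^bsub>grp A 0\<^esub>}"
proof -
  interpret comm_group "grp A 0" by (rule grp_comm_group)
  show ?thesis by (simp add: degenerate_def generate_empty)
qed

lemma degenerate_1: "degenerate A 1 = generate (grp A 1) (const_loop (underlying A) ` carrier (grp A 0))"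
proof -
  have "{gact A 1 (1 - 1) (degen 1 i) a | i a. 1 \<le> i \<and> i \<le> 1 \<and> a \<in> carrier (grp A (1 - 1))} =
      const_loop (underlying A) ` carrier (grp A 0)"
    by (auto simp: const_loop_def underlying_def)
  moreover have "{gact A 1 (1 - 1) (conn 1 i False) a | i a. 1 \<le> i \<and> i + 1 \<le> 1 \<and> a \<in> carrier (grp A (1 - 1))} = {}"
    by auto
  ultimately show ?thesis unfolding degenerate_def by simp
qed

lemma degenerate_normal: "degenerate A n \<lhd> grp A n"
proof -
  interpret comm_group "grp A n" by (rule grp_comm_group)
  have "gact A n (n - 1) (degen n i) a \<in> carrier (grp A n)"
    if "1 \<le> i" "i \<le> n" "a \<in> carrier (grp A (n - 1))" for i a
    using act_closed[OF box_degen[of i n]] that by (simp add: underlying_def)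
  moreover have "gact A n (n - 1) (conn n i False) a \<in> carrier (grp A n)"
    if "1 \<le> i" "i + 1 \<le> n" "a \<in> carrier (grp A (n - 1))" for i a
    using act_closed[OF box_conn[of i n]] that by (simp add: underlying_def)
  ultimately show ?thesis
    unfolding degenerate_def by (intro subgroup_imp_normal generate_is_subgroup) auto
qed

lemma const_loop_degenerate: "a \<in> carrier (grp A 0) \<Longrightarrow> const_loop (underlying A) a \<in> degenerate A 1"
  unfolding degenerate_1 by (rule generate.incl) simp

lemma cub_diff_1_degenerate: "cub_diff A 1 ` degenerate A 1 \<subseteq> degenerate A 0"
proof -
  interpret G0: comm_group "grp A 0" by (rule grp_comm_group)
  interpret G1: comm_group "grp A 1" by (rule grp_comm_group)
  interpret d: group_hom "grp A 1" "grp A 0" "cub_diff A 1" by (rule cub_diff_1_hom)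
  interpret c: group_hom "grp A 0" "grp A 1" "const_loop (underlying A)" by (rule const_loop_hom)
  have "degenerate A 1 \<subseteq> kernel (grp A 1) (grp A 0) (cub_diff A 1)"
    unfolding degenerate_1
  proof (rule G1.generate_subgroup_incl[OF _ d.subgroup_kernel])
    show "const_loop (underlying A) ` carrier (grp A 0) \<subseteq> kernel (grp A 1) (grp A 0) (cub_diff A 1)"
      by (auto simp: kernel_def cub_diff_1 edge_end_const_loop cells_underlying)
  qed
  then show ?thesis unfolding degenerate_0 kernel_def by blast
qed

text \<open>The two copies of \<open>a\<close> enter each boundary with opposite signs, so only
  constant edges remain, and for the connection these cancel as well. Hence the differential
  descends to the Moore complex in degree 2.\<close>

lemma cub_diff_2_degenerate: "cub_diff A 2 ` degenerate A 2 \<subseteq> degenerate A 1"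
proof -
  interpret G1: comm_group "grp A 1" by (rule grp_comm_group)
  interpret G2: comm_group "grp A 2" by (rule grp_comm_group)
  interpret d: group_hom "grp A 2" "grp A 1" "cub_diff A 2" by (rule cub_diff_2_hom)
  interpret D: normal "degenerate A 1" "grp A 1" by (rule degenerate_normal)
  interpret c: group_hom "grp A 0" "grp A 1" "const_loop (underlying A)" by (rule const_loop_hom)
  define gens where "gens = {gact A 2 1 (degen 2 1) a | a. a \<in> carrier (grp A 1)} \<union>
    {gact A 2 1 (degen 2 2) a | a. a \<in> carrier (grp A 1)} \<union>
    {gact A 2 1 (conn 2 1 False) a | a. a \<in> carrier (grp A 1)}"
  have "degenerate A 2 \<subseteq> generate (grp A 2) gens"
  proof -
    have *: "{gact A 2 (2 - 1) (degen 2 i) a | i a. 1 \<le> i \<and> i \<le> 2 \<and> a \<in> carrier (grp A (2 - 1))} \<union>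
      {gact A 2 (2 - 1) (conn 2 i False) a | i a. 1 \<le> i \<and> i + 1 \<le> 2 \<and> a \<in> carrier (grp A (2 - 1))} \<subseteq> gens"
    proof (intro Un_least subsetI)
      fix b assume "b \<in> {gact A 2 (2 - 1) (degen 2 i) a | i a. 1 \<le> i \<and> i \<le> 2 \<and> a \<in> carrier (grp A (2 - 1))}"
      then obtain i a where i: "1 \<le> i" "i \<le> 2" and b: "b = gact A 2 (2 - 1) (degen 2 i) a" "a \<in> carrier (grp A (2 - 1))"
        by blast
      then have "i = 1 \<or> i = 2" by auto
      with b show "b \<in> gens" by (auto simp: gens_def)
    next
      fix b assume "b \<in> {gact A 2 (2 - 1) (conn 2 i False) a | i a. 1 \<le> i \<and> i + 1 \<le> 2 \<and> a \<in> carrier (grp A (2 - 1))}"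
      then obtain i a where i: "1 \<le> i" "i + 1 \<le> 2" and b: "b = gact A 2 (2 - 1) (conn 2 i False) a" "a \<in> carrier (grp A (2 - 1))"
        by blast
      then have "i = 1" by auto
      with b show "b \<in> gens" by (auto simp: gens_def)
    qed
    then show ?thesis unfolding degenerate_def by (rule G2.mono_generate)
  qed
  also have "\<dots> \<subseteq> {a \<in> carrier (grp A 2). cub_diff A 2 a \<in> degenerate A 1}"
  proof (rule G2.generate_subgroup_incl)
    show "subgroup {a \<in> carrier (grp A 2). cub_diff A 2 a \<in> degenerate A 1} (grp A 2)"
      by (rule subgroup.intro) auto
    show "gens \<subseteq> {a \<in> carrier (grp A 2). cub_diff A 2 a \<in> degenerate A 1}"
    proof
      fix b assume "b \<in> gens"
      then obtain a where a: "a \<in> carrier (grp A 1)" and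
        b: "b = gact A 2 1 (degen 2 1) a \<or> b = gact A 2 1 (degen 2 2) a \<or> b = gact A 2 1 (conn 2 1 False) a"
        unfolding gens_def by blast
      have a': "a \<in> cells (underlying A) 1" using a by (simp add: cells_underlying)
      have e: "edge_end (underlying A) \<epsilon> a \<in> carrier (grp A 0)" for \<epsilon>
        using edge_end_closed[OF a'] by (simp add: cells_underlying)
      have bc: "b \<in> carrier (grp A 2)"
        using b act_closed[OF _ a'] box_degen[of 1 2] box_degen[of 2 2] box_conn[of 1 2]
        by (auto simp: underlying_def)
      define s where "s \<epsilon> = const_loop (underlying A) (edge_end (underlying A) \<epsilon> a)" for \<epsilon>
      have s: "s \<epsilon> \<in> degenerate A 1" for \<epsilon> unfolding s_def by (rule const_loop_degenerate[OF e])
      then have sc: "s \<epsilon> \<in> carrier (grp A 1)" for \<epsilon> by (rule D.mem_carrier)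
      have act: "act (underlying A) = gact A" by (simp add: underlying_def)
      note sides = degen_1_sides[OF a'] degen_2_sides[OF a'] conn_sides[OF a', of 1] conn_sides[OF a', of 2]
      note sides = sides[unfolded act, folded s_def]
      from b have "cub_diff A 2 b \<in> degenerate A 1"
      proof (elim disjE)
        assume "b = gact A 2 1 (degen 2 1) a"
        then have "cub_diff A 2 b = s False \<otimes>\<^bsub>grp A 1\<^esub> inv\<^bsub>grp A 1\<^esub> s True"
          using a sc unfolding cub_diff_2[OF bc] by (simp add: sides)
        then show ?thesis using s by simp
      next
        assume "b = gact A 2 1 (degen 2 2) a"
        then have "cub_diff A 2 b = inv\<^bsub>grp A 1\<^esub> s False \<otimes>\<^bsub>grp A 1\<^esub> s True"
          using a sc unfolding cub_diff_2[OF bc] by (simp add: sides)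
        then show ?thesis using s by simp
      next
        assume "b = gact A 2 1 (conn 2 1 False) a"
        then have "cub_diff A 2 b = (inv\<^bsub>grp A 1\<^esub> a \<otimes>\<^bsub>grp A 1\<^esub> s True) \<otimes>\<^bsub>grp A 1\<^esub> (a \<otimes>\<^bsub>grp A 1\<^esub> inv\<^bsub>grp A 1\<^esub> s True)"
          unfolding cub_diff_2[OF bc] by (simp add: sides)
        also have "\<dots> = (inv\<^bsub>grp A 1\<^esub> a \<otimes>\<^bsub>grp A 1\<^esub> s True) \<otimes>\<^bsub>grp A 1\<^esub> inv\<^bsub>grp A 1\<^esub> (inv\<^bsub>grp A 1\<^esub> a \<otimes>\<^bsub>grp A 1\<^esub> s True)"
          using a sc by (simp add: G1.inv_mult)
        finally show ?thesis using a sc by (simp del: G1.inv_mult)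
      qed
      with bc show "b \<in> {a \<in> carrier (grp A 2). cub_diff A 2 a \<in> degenerate A 1}" by simp
    qed
  qed
  finally show ?thesis by blast
qed

lemma moore_diff_class:
  assumes "n \<in> {1, 2}" "a \<in> carrier (grp A n)"
  shows "diff (moore A) n (moore_class A n a) = moore_class A (n - 1) (cub_diff A n a)"
  using assms quotient_map_coset[OF cub_diff_1_hom degenerate_normal degenerate_normal cub_diff_1_degenerate]
    quotient_map_coset[OF cub_diff_2_hom degenerate_normal degenerate_normal cub_diff_2_degenerate]
  by (auto simp: moore_def moore_class_def)

lemma chains_moore: "chains (moore A) n = grp A n Mod degenerate A n"
  by (simp add: moore_def)

lemma chains_comm_group: "comm_group (chains (moore A) n)"
proof -
  interpret comm_group "grp A n" by (rule grp_comm_group)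
  show ?thesis unfolding chains_moore
    using degenerate_normal normal_imp_subgroup by (intro abelian_FactGroup) blast
qed

lemma moore_class_hom: "group_hom (grp A n) (chains (moore A) n) (moore_class A n)"
  using chains_comm_group grp_comm_group normal.r_coset_hom_Mod[OF degenerate_normal]
  by (simp add: group_hom_def group_hom_axioms_def comm_group.axioms(2) chains_moore moore_class_def[abs_def])

lemma carrier_chains: "carrier (chains (moore A) n) = moore_class A n ` carrier (grp A n)"
  by (simp add: chains_moore carrier_FactGroup moore_class_def[abs_def])

lemma boundaries_1: "boundaries (moore A) 1 = (\<lambda>z. moore_class A 1 (cub_diff A 2 z)) ` carrier (grp A 2)"
  by (simp add: boundaries_def carrier_chains image_image moore_diff_class cong: image_cong)

text \<open>The degenerate part in degree 0 is trivial, so a representative of a cycle has zero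
  boundary on the nose and not merely up to degenerate chains.\<close>

lemma cycles_1: "cycles (moore A) 1 = moore_class A 1 ` {a \<in> carrier (grp A 1). cub_diff A 1 a = \<one>\<^bsub>grp A 0\<^esub>}"
proof -
  interpret G0: comm_group "grp A 0" by (rule grp_comm_group)
  interpret d: group_hom "grp A 1" "grp A 0" "cub_diff A 1" by (rule cub_diff_1_hom)
  have "moore_class A 0 b = \<one>\<^bsub>chains (moore A) 0\<^esub> \<longleftrightarrow> b = \<one>\<^bsub>grp A 0\<^esub>" if "b \<in> carrier (grp A 0)" for b
    using that by (auto simp: moore_class_def chains_moore degenerate_0 r_coset_def)
  then have "diff (moore A) 1 (moore_class A 1 a) = \<one>\<^bsub>chains (moore A) 0\<^esub> \<longleftrightarrow> cub_diff A 1 a = \<one>\<^bsub>grp A 0\<^esub>"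
    if "a \<in> carrier (grp A 1)" for a
    using that by (simp add: moore_diff_class)
  then show ?thesis
    by (auto simp: cycles_def kernel_def carrier_chains)
qed

lemma boundaries_normal: "boundaries (moore A) 1 \<lhd> chains (moore A) 1"
proof -
  interpret C: comm_group "chains (moore A) 1" by (rule chains_comm_group)
  have "(moore_class A 1 \<circ> cub_diff A 2) \<in> hom (grp A 2) (chains (moore A) 1)"
    using group_hom.homh[OF cub_diff_2_hom] group_hom.homh[OF moore_class_hom] by (rule hom_compose)
  then interpret group_hom "grp A 2" "chains (moore A) 1" "moore_class A 1 \<circ> cub_diff A 2"
    using grp_comm_group C.is_group by (simp add: group_hom_def group_hom_axioms_def comm_group.axioms(2))
  show ?thesis
    using img_is_subgroup unfolding boundaries_1 by (intro C.subgroup_imp_normal) (simp add: image_comp comp_def)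
qed

text \<open>The first homology group lives inside the quotient of all \<open>1\<close>-chains by the boundaries, with the
  same multiplication and unit; homomorphisms are checked there.\<close>

definition chain_quotient :: "'a set set monoid" where
  "chain_quotient = chains (moore A) 1 Mod boundaries (moore A) 1"

definition chain_class :: "'a \<Rightarrow> 'a set set" where
  "chain_class a = homology_class 1 (moore A) (moore_class A 1 a)"

lemma chain_class_coset: "chain_class a = boundaries (moore A) 1 #>\<^bsub>chains (moore A) 1\<^esub> moore_class A 1 a"
  by (simp add: chain_class_def homology_class_def cycle_group_def r_coset_def)

lemma chain_quotient_comm_group: "comm_group chain_quotient"
  unfolding chain_quotient_def
  by (intro comm_group.abelian_FactGroup chains_comm_group normal_imp_subgroup boundaries_normal)

lemma chain_class_hom: "group_hom (grp A 1) chain_quotient chain_class"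
proof -
  have "((\<lambda>c. boundaries (moore A) 1 #>\<^bsub>chains (moore A) 1\<^esub> c) \<circ> moore_class A 1) \<in> hom (grp A 1) chain_quotient"
    unfolding chain_quotient_def
    by (rule hom_compose[OF group_hom.homh[OF moore_class_hom] normal.r_coset_hom_Mod[OF boundaries_normal]])
  then show ?thesis
    using chain_quotient_comm_group grp_comm_group
    by (simp add: group_hom_def group_hom_axioms_def comm_group.axioms(2) comp_def chain_class_coset[abs_def])
qed

lemma carrier_homology:
  "carrier (homology 1 (moore A)) = chain_class ` {a \<in> carrier (grp A 1). cub_diff A 1 a = \<one>\<^bsub>grp A 0\<^esub>}"
  by (auto simp: homology_def carrier_FactGroup cycle_group_def cycles_1 chain_class_coset r_coset_def)

text \<open>Multiplication in a factor group is multiplication of sets, which does not look at the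
  carrier; restricting to cycles leaves it unchanged.\<close>

lemma mult_homology: "monoid.mult (homology 1 (moore A)) = monoid.mult chain_quotient"
  by (simp add: homology_def chain_quotient_def cycle_group_def set_mult_def fun_eq_iff)

lemma one_homology: "\<one>\<^bsub>homology 1 (moore A)\<^esub> = \<one>\<^bsub>chain_quotient\<^esub>"
  by (simp add: homology_def chain_quotient_def)

lemma chain_class_boundary:
  assumes "z \<in> carrier (grp A 2)"
  shows "chain_class (cub_diff A 2 z) = \<one>\<^bsub>chain_quotient\<^esub>"
proof -
  interpret C: comm_group "chains (moore A) 1" by (rule chains_comm_group)
  interpret B: normal "boundaries (moore A) 1" "chains (moore A) 1" by (rule boundaries_normal)
  have "moore_class A 1 (cub_diff A 2 z) \<in> boundaries (moore A) 1"
    using assms by (simp add: boundaries_1)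
  then show ?thesis
    unfolding chain_class_coset chain_quotient_def one_FactGroup
    using C.coset_join2 B.mem_carrier B.is_subgroup by blast
qed

lemma chain_class_const:
  assumes "v \<in> carrier (grp A 0)"
  shows "chain_class (const_loop (underlying A) v) = \<one>\<^bsub>chain_quotient\<^esub>"
proof -
  interpret G1: comm_group "grp A 1" by (rule grp_comm_group)
  interpret D: normal "degenerate A 1" "grp A 1" by (rule degenerate_normal)
  interpret m: group_hom "grp A 1" "chains (moore A) 1" "moore_class A 1" by (rule moore_class_hom)
  interpret c: group_hom "grp A 1" chain_quotient chain_class by (rule chain_class_hom)
  have "moore_class A 1 (const_loop (underlying A) v) = moore_class A 1 \<one>\<^bsub>grp A 1\<^esub>"
    unfolding moore_class_def
    using G1.coset_join2[OF _ D.is_subgroup] const_loop_degenerate[OF assms] D.mem_carrier D.one_closed by metis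
  then show ?thesis using c.hom_one by (simp add: chain_class_coset)
qed

text \<open>A chain of trivial class is a boundary up to degenerate chains, so a homomorphism
  killing both kinds kills it. This is the universal property of \<open>chain_quotient\<close>, in
  the form needed to test elements of a kernel.\<close>

lemma chain_class_kernel:
  assumes f: "group_hom (grp A 1) H f" and a: "a \<in> carrier (grp A 1)" "chain_class a = \<one>\<^bsub>chain_quotient\<^esub>"
    and deg: "\<And>v. v \<in> carrier (grp A 0) \<Longrightarrow> f (const_loop (underlying A) v) = \<one>\<^bsub>H\<^esub>"
    and bd: "\<And>z. z \<in> carrier (grp A 2) \<Longrightarrow> f (cub_diff A 2 z) = \<one>\<^bsub>H\<^esub>"
  shows "f a = \<one>\<^bsub>H\<^esub>"
proof -
  interpret f: group_hom "grp A 1" H f by fact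
  interpret C: comm_group "chains (moore A) 1" by (rule chains_comm_group)
  interpret B: normal "boundaries (moore A) 1" "chains (moore A) 1" by (rule boundaries_normal)
  interpret D: normal "degenerate A 1" "grp A 1" by (rule degenerate_normal)
  interpret m: group_hom "grp A 1" "chains (moore A) 1" "moore_class A 1" by (rule moore_class_hom)
  interpret d: group_hom "grp A 2" "grp A 1" "cub_diff A 2" by (rule cub_diff_2_hom)
  have fD: "f e = \<one>\<^bsub>H\<^esub>" if "e \<in> degenerate A 1" for e
  proof -
    have "degenerate A 1 \<subseteq> kernel (grp A 1) H f"
      unfolding degenerate_1
    proof (rule f.G.generate_subgroup_incl[OF _ f.subgroup_kernel])
      show "const_loop (underlying A) ` carrier (grp A 0) \<subseteq> kernel (grp A 1) H f"
        using deg group_hom.hom_closed[OF const_loop_hom] by (auto simp: kernel_def)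
    qed
    then show ?thesis using that by (auto simp: kernel_def)
  qed
  have "moore_class A 1 a \<in> boundaries (moore A) 1"
    using a C.rcos_self[OF _ B.is_subgroup] unfolding chain_class_coset chain_quotient_def one_FactGroup
    by (metis m.hom_closed)
  then obtain z where z: "z \<in> carrier (grp A 2)" "moore_class A 1 a = moore_class A 1 (cub_diff A 2 z)"
    unfolding boundaries_1 by blast
  then have "a \<in> degenerate A 1 #>\<^bsub>grp A 1\<^esub> cub_diff A 2 z"
    using f.G.rcos_self[OF a(1) D.is_subgroup] by (simp add: moore_class_def)
  then obtain e where e: "e \<in> degenerate A 1" "a = e \<otimes>\<^bsub>grp A 1\<^esub> cub_diff A 2 z"
    by (auto simp: r_coset_def)
  then show ?thesis using fD bd z D.mem_carrier by simp
qed

lemma one_vertex: "\<one>\<^bsub>grp A 0\<^esub> \<in> cells (underlying A) 0"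
proof -
  interpret comm_group "grp A 0" by (rule grp_comm_group)
  show ?thesis by (simp add: cells_underlying)
qed

lemma const_loop_one: "const_loop (underlying A) \<one>\<^bsub>grp A 0\<^esub> = \<one>\<^bsub>grp A 1\<^esub>"
  using group_hom.hom_one[OF const_loop_hom] .

text \<open>In the abelian group of 1-chains, \<open>b r\<close> and \<open>l t\<close> differ by
  the boundary of the square.\<close>

lemma chain_class_square:
  assumes "square (underlying A) l t b r"
  shows "chain_class l \<otimes>\<^bsub>chain_quotient\<^esub> chain_class t = chain_class b \<otimes>\<^bsub>chain_quotient\<^esub> chain_class r"
proof -
  interpret Q: comm_group chain_quotient by (rule chain_quotient_comm_group)
  interpret G1: comm_group "grp A 1" by (rule grp_comm_group)
  interpret c: group_hom "grp A 1" chain_quotient chain_class by (rule chain_class_hom)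
  have car: "l \<in> carrier (grp A 1)" "t \<in> carrier (grp A 1)" "b \<in> carrier (grp A 1)" "r \<in> carrier (grp A 1)"
    using square_ends(1-4)[OF assms] by (simp_all add: cells_underlying)
  obtain s where s: "s \<in> carrier (grp A 2)"
    "cub_diff A 2 s = (inv\<^bsub>grp A 1\<^esub> l \<otimes>\<^bsub>grp A 1\<^esub> r) \<otimes>\<^bsub>grp A 1\<^esub> (b \<otimes>\<^bsub>grp A 1\<^esub> inv\<^bsub>grp A 1\<^esub> t)"
    using assms unfolding square_def by (auto simp: cub_diff_2 cells_underlying)
  have "b \<otimes>\<^bsub>grp A 1\<^esub> r = (l \<otimes>\<^bsub>grp A 1\<^esub> t) \<otimes>\<^bsub>grp A 1\<^esub> cub_diff A 2 s"
    using car by (simp add: s(2) G1.m_ac G1.m_lcomm)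
  moreover have "cub_diff A 2 s \<in> carrier (grp A 1)" using car by (simp add: s(2))
  ultimately show ?thesis
    using car chain_class_boundary[OF s(1)] by (metis G1.m_closed Q.r_one c.hom_closed c.hom_mult)
qed

text \<open>The generating homotopies are squares whose left and right sides are neutral, so they
  preserve the class; induction carries this through the generated equivalence and makes the set
  under \<open>the_elem\<close> a singleton.\<close>

lemma pi1_to_homology_class:
  assumes a: "a \<in> loops (underlying A) \<one>\<^bsub>grp A 0\<^esub>"
  shows "pi1_to_homology A (loop_class (underlying A) \<one>\<^bsub>grp A 0\<^esub> a) = chain_class a"
proof -
  let ?U = "underlying A" and ?R = "\<lambda>u v. square (underlying A) \<one>\<^bsub>grp A 1\<^esub> v u \<one>\<^bsub>grp A 1\<^esub>"
  interpret Q: comm_group chain_quotient by (rule chain_quotient_comm_group)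
  interpret c: group_hom "grp A 1" chain_quotient chain_class by (rule chain_class_hom)
  have rel: "pi0_rel (loop_space ?U \<one>\<^bsub>grp A 0\<^esub>) = {(u, v). u \<in> loops ?U \<one>\<^bsub>grp A 0\<^esub> \<and> v \<in> loops ?U \<one>\<^bsub>grp A 0\<^esub> \<and> equivclp ?R u v}"
    unfolding pi0_rel_def loop_space_cells_0[OF one_vertex] loop_space_edge_iff[OF one_vertex] const_loop_one ..
  have step: "chain_class v = chain_class u" if "?R u v" for u v
    using chain_class_square[OF that] square_ends(2,3)[OF that] by (simp add: cells_underlying)
  have "chain_class v = chain_class u" if "equivclp ?R u v" for u v
    using that by (induction rule: equivclp_induct) (use step in auto)
  then have "chain_class ` loop_class ?U \<one>\<^bsub>grp A 0\<^esub> a = {chain_class a}"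
    using a unfolding pi0_class_def rel by (auto intro!: image_eqI[of _ _ a])
  then show ?thesis by (simp add: pi1_to_homology_def chain_class_def[abs_def])
qed

end

section \<open>The free cubical abelian group\<close>

context pointed_cubical
begin

abbreviation chain_group :: "nat \<Rightarrow> ('a \<Rightarrow>\<^sub>0 int) monoid" where
  "chain_group n \<equiv> free_Abelian_group (cells X n)"

definition push :: "nat \<Rightarrow> nat \<Rightarrow> box_map \<Rightarrow> ('a \<Rightarrow>\<^sub>0 int) \<Rightarrow> ('a \<Rightarrow>\<^sub>0 int)" where
  "push m n \<phi> = frag_extend (\<lambda>z. frag_of (act X m n \<phi> z))"

definition free_class :: "nat \<Rightarrow> ('a \<Rightarrow>\<^sub>0 int) \<Rightarrow> ('a \<Rightarrow>\<^sub>0 int) set" where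
  "free_class n c = base_subgroup X x n #>\<^bsub>chain_group n\<^esub> c"

lemma push_hom:
  assumes "box_hom m n \<phi>"
  shows "group_hom (chain_group n) (chain_group m) (push m n \<phi>)"
proof -
  have "push m n \<phi> c \<in> carrier (chain_group m)" if "c \<in> carrier (chain_group n)" for c
    using that act_closed[OF assms] keys_frag_extend[of "\<lambda>z. frag_of (act X m n \<phi> z)" c]
    by (fastforce simp: push_def)
  then show ?thesis
    by (auto simp: group_hom_def group_hom_axioms_def hom_def push_def frag_extend_add)
qed

lemma base_subgroup_normal: "base_subgroup X x n \<lhd> chain_group n"
proof -
  interpret comm_group "chain_group n" by (rule abelian_free_Abelian_group)
  show ?thesis
    unfolding base_subgroup_def
    by (intro subgroup_imp_normal generate_is_subgroup) (simp add: const_cube_closed base)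
qed

text \<open>Constant cubes at \<open>x\<close> go to constant cubes at \<open>x\<close>, so the
  linear extension descends to the quotient.\<close>

lemma push_base_subgroup:
  assumes "box_hom m n \<phi>"
  shows "push m n \<phi> ` base_subgroup X x n \<subseteq> base_subgroup X x m"
proof -
  interpret group_hom "chain_group n" "chain_group m" "push m n \<phi>" by (rule push_hom[OF assms])
  have "push m n \<phi> (frag_of (const_cube X x n)) = frag_of (const_cube X x m)"
    by (simp add: push_def act_const_cube base assms)
  then show ?thesis
    unfolding base_subgroup_def
    using generate_img[of "{frag_of (const_cube X x n)}"] by (simp add: const_cube_closed base)
qed

lemma grp_free: "grp (free_cubical X x) n = chain_group n Mod base_subgroup X x n"
  by (simp add: free_cubical_def)

lemma carrier_free: "carrier (grp (free_cubical X x) n) = free_class n ` carrier (chain_group n)"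
  by (simp add: grp_free carrier_FactGroup free_class_def[abs_def])

lemma comm_group_free: "comm_group (grp (free_cubical X x) n)"
  unfolding grp_free
  by (intro comm_group.abelian_FactGroup abelian_free_Abelian_group normal_imp_subgroup base_subgroup_normal)

lemma free_class_hom: "group_hom (chain_group n) (grp (free_cubical X x) n) (free_class n)"
  using comm_group_free normal.r_coset_hom_Mod[OF base_subgroup_normal]
  by (simp add: group_hom_def group_hom_axioms_def comm_group.axioms(2) grp_free free_class_def[abs_def])

lemma gact_free_class:
  "box_hom m n \<phi> \<Longrightarrow> c \<in> carrier (chain_group n) \<Longrightarrow>
    gact (free_cubical X x) m n \<phi> (free_class n c) = free_class m (push m n \<phi> c)"
  using quotient_map_coset[OF push_hom base_subgroup_normal base_subgroup_normal push_base_subgroup]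
  by (simp add: free_cubical_def free_class_def push_def)

lemma push_id: "c \<in> carrier (chain_group n) \<Longrightarrow> push n n (\<lambda>v\<in>vertices n. v) c = c"
  unfolding push_def using frag_extend_eq[of c "\<lambda>z. frag_of (act X n n (\<lambda>v\<in>vertices n. v) z)" frag_of]
  by (auto simp: act_id subset_iff simp flip: frag_expansion)

lemma push_comp:
  assumes "box_hom l m \<phi>" "box_hom m n \<psi>" "c \<in> carrier (chain_group n)"
  shows "push l n (compose (vertices l) \<psi> \<phi>) c = push l m \<phi> (push m n \<psi> c)"
proof -
  have "push l n (compose (vertices l) \<psi> \<phi>) c = frag_extend ((\<lambda>z. frag_of (act X l m \<phi> z)) \<circ> act X m n \<psi>) c"
    unfolding push_def using assms by (intro frag_extend_eq) (auto simp: act_comp subset_iff)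
  then show ?thesis
    using frag_extend_compose[of "\<lambda>z. frag_of (act X l m \<phi> z)" "act X m n \<psi>" c] by (simp add: push_def comp_def)
qed

lemma cubical_abelian_group_free: "cubical_abelian_group (free_cubical X x)"
proof (intro cubical_abelian_group.intro cubical_set.intro cubical_abelian_group_axioms.intro comm_group_free)
  let ?A = "free_cubical X x"
  have U: "cells (underlying ?A) n = free_class n ` carrier (chain_group n)" "act (underlying ?A) = gact ?A" for n
    by (simp_all add: underlying_def carrier_free)
  have push: "push m n \<phi> c \<in> carrier (chain_group m)" if "box_hom m n \<phi>" "c \<in> carrier (chain_group n)" for m n \<phi> c
    using group_hom.hom_closed[OF push_hom[OF that(1)] that(2)] .
  show "act (underlying ?A) m n \<phi> z \<in> cells (underlying ?A) m"
    if "box_hom m n \<phi>" "z \<in> cells (underlying ?A) n" for m n \<phi> z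
    using that push[OF that(1)] unfolding U by (auto simp only: gact_free_class)
  show "act (underlying ?A) n n (\<lambda>v\<in>vertices n. v) z = z" if "z \<in> cells (underlying ?A) n" for n z
    using that push_id unfolding U by (auto simp only: gact_free_class[OF box_id])
  show "act (underlying ?A) l n (compose (vertices l) \<psi> \<phi>) z = act (underlying ?A) l m \<phi> (act (underlying ?A) m n \<psi> z)"
    if "box_hom l m \<phi>" "box_hom m n \<psi>" "z \<in> cells (underlying ?A) n" for l m \<phi> n \<psi> z
    using that(3) push[OF that(2)] push_comp[OF that(1,2)] unfolding U
    by (auto simp only: gact_free_class[OF that(1)] gact_free_class[OF that(2)] gact_free_class[OF box_comp[OF that(1,2)]])
  show "gact ?A m n \<phi> \<in> hom (grp ?A n) (grp ?A m)" if "box_hom m n \<phi>" for m n \<phi>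
    using quotient_map_hom[OF push_hom[OF that] base_subgroup_normal base_subgroup_normal push_base_subgroup[OF that]]
    unfolding grp_free by (simp add: free_cubical_def push_def)
qed

end

sublocale pointed_cubical \<subseteq> free: cubical_abelian_group "free_cubical X x"
  by (rule cubical_abelian_group_free)

context pointed_cubical
begin

lemma unit_map_free_class: "unit_map X x n z = free_class n (frag_of z)"
  by (simp add: unit_map_def free_class_def)

lemma unit_map_closed: "z \<in> cells X n \<Longrightarrow> unit_map X x n z \<in> carrier (grp (free_cubical X x) n)"
  by (simp add: unit_map_free_class carrier_free)

lemma unit_map_const: "unit_map X x n (const_cube X x n) = \<one>\<^bsub>grp (free_cubical X x) n\<^esub>"
proof -
  interpret normal "base_subgroup X x n" "chain_group n" by (rule base_subgroup_normal)
  have "frag_of (const_cube X x n) \<in> base_subgroup X x n"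
    unfolding base_subgroup_def by (rule generate.incl) simp
  then show ?thesis
    unfolding grp_free one_FactGroup unit_map_def using is_subgroup mem_carrier by (intro coset_join2)
qed

lemma act_unit_map:
  "box_hom m n \<phi> \<Longrightarrow> z \<in> cells X n \<Longrightarrow>
    act (underlying (free_cubical X x)) m n \<phi> (unit_map X x n z) = unit_map X x m (act X m n \<phi> z)"
  by (simp add: unit_map_free_class underlying_def gact_free_class push_def)

lemma edge_end_unit_map:
  "e \<in> cells X 1 \<Longrightarrow> edge_end (underlying (free_cubical X x)) \<epsilon> (unit_map X x 1 e) = unit_map X x 0 (edge_end X \<epsilon> e)"
  using act_unit_map[OF box_face[of 1 1 \<epsilon>]] by (simp add: edge_end_def)

lemma square_side_unit_map:
  "i \<in> {1, 2} \<Longrightarrow> s \<in> cells X 2 \<Longrightarrow>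
    square_side (underlying (free_cubical X x)) i \<epsilon> (unit_map X x 2 s) = unit_map X x 1 (square_side X i \<epsilon> s)"
  using act_unit_map[OF box_face[of i 2 \<epsilon>]] by (auto simp: square_side_def)

lemma const_loop_unit_map:
  "v \<in> cells X 0 \<Longrightarrow> const_loop (underlying (free_cubical X x)) (unit_map X x 0 v) = unit_map X x 1 (const_loop X v)"
  using act_unit_map[OF box_degen[of 1 1]] by (simp add: const_loop_def)

lemma unit_map_base: "unit_map X x 0 x = \<one>\<^bsub>grp (free_cubical X x) 0\<^esub>"
  using unit_map_const[of 0] by (simp add: const_cube_0 base)

lemma square_unit_map:
  assumes "square X l t b r"
  shows "square (underlying (free_cubical X x)) (unit_map X x 1 l) (unit_map X x 1 t) (unit_map X x 1 b) (unit_map X x 1 r)"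
proof -
  obtain s where s: "s \<in> cells X 2" "square_side X 1 False s = l" "square_side X 2 True s = t"
    "square_side X 2 False s = b" "square_side X 1 True s = r"
    using assms by (auto simp: square_def)
  have "unit_map X x 2 s \<in> cells (underlying (free_cubical X x)) 2"
    using unit_map_closed[OF s(1)] by (simp add: underlying_def)
  then show ?thesis
    unfolding square_def using s by (intro bexI[of _ "unit_map X x 2 s"]) (auto simp: square_side_unit_map)
qed

lemma loops_unit_map:
  "u \<in> loops X x \<Longrightarrow> unit_map X x 1 u \<in> loops (underlying (free_cubical X x)) \<one>\<^bsub>grp (free_cubical X x) 0\<^esub>"
  using unit_map_closed[of u 1] by (simp add: loops_def underlying_def[THEN arg_cong[of _ _ cells]] edge_end_unit_map unit_map_base)

section \<open>Homomorphisms out of the free cubical abelian group\<close>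

text \<open>The chains sent into \<open>I\<close> are closed under differences, so the cubes decide.
  This serves with \<open>I\<close> trivial, to show that a homomorphism vanishes, and with
  \<open>I\<close> the image of the Hurewicz map.\<close>

lemma free_hom_in_subgroup:
  assumes f: "group_hom (grp (free_cubical X x) n) H f" and I: "subgroup I H"
    and gen: "\<And>z. z \<in> cells X n \<Longrightarrow> f (unit_map X x n z) \<in> I"
    and a: "a \<in> carrier (grp (free_cubical X x) n)"
  shows "f a \<in> I"
proof -
  interpret f: group_hom "grp (free_cubical X x) n" H f by fact
  interpret I: subgroup I H by fact
  interpret c: group_hom "chain_group n" "grp (free_cubical X x) n" "free_class n" by (rule free_class_hom)
  obtain c where c: "Poly_Mapping.keys c \<subseteq> cells X n" "a = free_class n c"
    using a by (auto simp: carrier_free)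
  from c(1) have "f (free_class n c) \<in> I"
  proof (rule free_Abelian_group_induct)
    show "f (free_class n 0) \<in> I" using c.hom_one by simp
    show "f (free_class n (b - d)) \<in> I"
      if keys: "Poly_Mapping.keys b \<subseteq> cells X n" "Poly_Mapping.keys d \<subseteq> cells X n"
        and I': "f (free_class n b) \<in> I" "f (free_class n d) \<in> I" for b d
    proof -
      have bd: "b \<in> carrier (chain_group n)" "d \<in> carrier (chain_group n)" using keys by simp_all
      have "free_class n (b \<otimes>\<^bsub>chain_group n\<^esub> inv\<^bsub>chain_group n\<^esub> d) =
          free_class n b \<otimes>\<^bsub>grp (free_cubical X x) n\<^esub> inv\<^bsub>grp (free_cubical X x) n\<^esub> free_class n d"
        by (simp only: c.hom_mult[OF bd(1) group.inv_closed[OF group_free_Abelian_group bd(2)]] c.hom_inv[OF bd(2)])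
      then have "free_class n (b - d) = free_class n b \<otimes>\<^bsub>grp (free_cubical X x) n\<^esub> inv\<^bsub>grp (free_cubical X x) n\<^esub> free_class n d"
        using keys by simp
      moreover have "free_class n b \<in> carrier (grp (free_cubical X x) n)" "free_class n d \<in> carrier (grp (free_cubical X x) n)"
        using bd by (simp_all only: c.hom_closed)
      ultimately show ?thesis using I' by simp
    qed
    show "f (free_class n (frag_of z)) \<in> I" if "z \<in> cells X n" for z
      using gen[OF that] by (simp add: unit_map_free_class)
  qed
  then show ?thesis by (simp add: c)
qed

lemma free_hom_trivial:
  assumes f: "group_hom (grp (free_cubical X x) n) H f"
    and gen: "\<And>z. z \<in> cells X n \<Longrightarrow> f (unit_map X x n z) = \<one>\<^bsub>H\<^esub>"
    and a: "a \<in> carrier (grp (free_cubical X x) n)"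
  shows "f a = \<one>\<^bsub>H\<^esub>"
  using free_hom_in_subgroup[OF f group.triv_subgroup _ a] gen f by (simp add: group_hom_def)

text \<open>Freeness on a pointed set in one degree: the condition at the constant cube lets the
  homomorphism on free chains pass to the quotient by \<open>base_subgroup\<close>.\<close>

lemma free_universal:
  assumes H: "comm_group H" and f: "f \<in> cells X n \<rightarrow> carrier H" "f (const_cube X x n) = \<one>\<^bsub>H\<^esub>"
  obtains g where "group_hom (grp (free_cubical X x) n) H g" "\<And>z. z \<in> cells X n \<Longrightarrow> g (unit_map X x n z) = f z"
proof -
  interpret H: comm_group H by fact
  interpret F: comm_group "chain_group n" by (rule abelian_free_Abelian_group)
  obtain h where h: "h \<in> hom (chain_group n) H" "\<And>z. z \<in> cells X n \<Longrightarrow> h (frag_of z) = f z"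
    using H.free_Abelian_group_universal[of f "cells X n"] f(1) by blast
  interpret h: group_hom "chain_group n" H h
    using h(1) by (simp add: group_hom_def group_hom_axioms_def)
  have "base_subgroup X x n \<subseteq> kernel (chain_group n) H h"
    unfolding base_subgroup_def
    using h(2) f(2) const_cube_closed[OF base]
    by (intro F.generate_subgroup_incl[OF _ h.subgroup_kernel]) (simp add: kernel_def)
  then obtain g where g: "g \<in> hom (chain_group n Mod base_subgroup X x n) H"
    "\<And>c. c \<in> carrier (chain_group n) \<Longrightarrow> g (base_subgroup X x n #>\<^bsub>chain_group n\<^esub> c) = h c"
    using h.FactGroup_universal_kernel[OF base_subgroup_normal] by blast
  show thesis
  proof (rule that[of g])
    show "group_hom (grp (free_cubical X x) n) H g"
      using g(1) comm_group_free by (simp add: group_hom_def group_hom_axioms_def comm_group.axioms(2) grp_free)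
    show "g (unit_map X x n z) = f z" if "z \<in> cells X n" for z
      using g(2)[of "frag_of z"] h(2) that by (simp add: unit_map_def)
  qed
qed

end

section \<open>The Hurewicz homomorphism\<close>

text \<open>Stated over a bare cubical set because it is applied to the underlying cubical set of
  the free group, where the loop relation is at hand only as a generated equivalence.\<close>

lemma (in cubical_set) loop_class_eq:
  assumes "x \<in> cells X 0" "square X (const_loop X x) v u (const_loop X x)"
  shows "loop_class X x u = loop_class X x v"
proof -
  let ?R = "\<lambda>u v. square X (const_loop X x) v u (const_loop X x)"
  have rel: "pi0_rel (loop_space X x) = {(u, v). u \<in> loops X x \<and> v \<in> loops X x \<and> equivclp ?R u v}"
    unfolding pi0_rel_def loop_space_cells_0[OF assms(1)] loop_space_edge_iff[OF assms(1)] ..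
  have "u \<in> loops X x" "v \<in> loops X x"
    using square_ends[OF assms(2)] assms(1) by (auto simp: loops_def all_bool_eq edge_end_const_loop)
  moreover have "equivclp ?R u v" "equivclp ?R v u"
    using assms(2) by (auto intro: r_into_equivclp equivclp_sym)
  ultimately show ?thesis
    unfolding pi0_class_def rel by (auto intro: equivclp_trans)
qed

context pointed_kan
begin

abbreviation edge_class :: "'a \<Rightarrow> ('a \<Rightarrow>\<^sub>0 int) set set set" where
  "edge_class e \<equiv> free.chain_class (unit_map X x 1 e)"

lemma edge_class_closed: "e \<in> cells X 1 \<Longrightarrow> edge_class e \<in> carrier free.chain_quotient"
  by (rule group_hom.hom_closed[OF free.chain_class_hom unit_map_closed])

lemma edge_class_const: "v \<in> cells X 0 \<Longrightarrow> edge_class (const_loop X v) = \<one>\<^bsub>free.chain_quotient\<^esub>"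
  using free.chain_class_const[OF unit_map_closed] by (simp add: const_loop_unit_map)

lemma edge_class_square:
  assumes "square X l t b r"
  shows "edge_class l \<otimes>\<^bsub>free.chain_quotient\<^esub> edge_class t = edge_class b \<otimes>\<^bsub>free.chain_quotient\<^esub> edge_class r"
  by (rule free.chain_class_square[OF square_unit_map[OF assms]])

text \<open>The unit carries homotopic loops to homotopic loops, so the nested choices of
  representatives collapse and the map is computed on one edge.\<close>

lemma hurewicz_cls:
  assumes u: "u \<in> loops X x"
  shows "hurewicz X x (cls u) = edge_class u"
proof -
  let ?A = "free_cubical X x"
  have "loop_class (underlying ?A) \<one>\<^bsub>grp ?A 0\<^esub> (unit_map X x 1 v) = loop_class (underlying ?A) \<one>\<^bsub>grp ?A 0\<^esub> (unit_map X x 1 u)"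
    if "v \<in> cls u" for v
  proof -
    have "square X \<e> v u \<e>" using that by (simp add: mem_cls)
    from square_unit_map[OF this] show ?thesis
      using free.loop_class_eq[OF free.one_vertex] const_loop_unit_map[OF base] by (simp add: unit_map_base)
  qed
  then have "(\<lambda>v. loop_class (underlying ?A) \<one>\<^bsub>grp ?A 0\<^esub> (unit_map X x 1 v)) ` cls u =
      (\<lambda>v. loop_class (underlying ?A) \<one>\<^bsub>grp ?A 0\<^esub> (unit_map X x 1 u)) ` cls u"
    by (rule image_cong[OF refl])
  also have "\<dots> = {loop_class (underlying ?A) \<one>\<^bsub>grp ?A 0\<^esub> (unit_map X x 1 u)}"
    by (rule image_constant[of u]) (use homotopic_refl u in \<open>simp add: mem_cls\<close>)
  finally have "(\<lambda>v. loop_class (underlying ?A) \<one>\<^bsub>grp ?A 0\<^esub> (unit_map X x 1 v)) ` cls u =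
      {loop_class (underlying ?A) \<one>\<^bsub>grp ?A 0\<^esub> (unit_map X x 1 u)}" .
  then show ?thesis
    using free.pi1_to_homology_class[OF loops_unit_map[OF u]] by (simp add: hurewicz_def pi1_map_def)
qed

text \<open>A product square has a constant right side, whose class is trivial, so its relation
  becomes multiplicativity. That the values are classes of cycles is left to
  \<open>hurewicz_closed\<close>.\<close>

lemma hurewicz_hom: "group_hom (pi1 X x) free.chain_quotient (hurewicz X x)"
proof -
  interpret Q: comm_group free.chain_quotient by (rule free.chain_quotient_comm_group)
  have "hurewicz X x \<in> hom (pi1 X x) free.chain_quotient"
  proof (rule homI)
    show "hurewicz X x A \<in> carrier free.chain_quotient" if "A \<in> carrier (pi1 X x)" for A
      using that edge_class_closed by (auto simp: carrier_pi1 hurewicz_cls loops_def)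
    fix A B assume "A \<in> carrier (pi1 X x)" "B \<in> carrier (pi1 X x)"
    then obtain u v where uv: "A = cls u" "B = cls v" "u \<in> loops X x" "v \<in> loops X x"
      unfolding carrier_pi1 by blast
    obtain w where w: "square X u v w \<e>" "w \<in> loops X x" using product_exists uv(3,4) by blast
    have "edge_class w \<in> carrier free.chain_quotient" using w edge_class_closed by (simp add: loops_def)
    then have "edge_class u \<otimes>\<^bsub>free.chain_quotient\<^esub> edge_class v = edge_class w"
      using edge_class_square[OF w(1)] edge_class_const[OF base] by simp
    then show "hurewicz X x (A \<otimes>\<^bsub>pi1 X x\<^esub> B) = hurewicz X x A \<otimes>\<^bsub>free.chain_quotient\<^esub> hurewicz X x B"
      using uv w mult_pi1[OF w(1) uv(3)] by (simp add: hurewicz_cls)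
  qed
  then show ?thesis using group_pi1 Q.is_group by (simp add: group_hom_def group_hom_axioms_def)
qed

lemma reduced_homology_1:
  "carrier (reduced_homology 1 X x) = free.chain_class ` {a \<in> carrier (grp (free_cubical X x) 1).
     cub_diff (free_cubical X x) 1 a = \<one>\<^bsub>grp (free_cubical X x) 0\<^esub>}"
  "monoid.mult (reduced_homology 1 X x) = monoid.mult free.chain_quotient"
  "\<one>\<^bsub>reduced_homology 1 X x\<^esub> = \<one>\<^bsub>free.chain_quotient\<^esub>"
  by (simp_all only: reduced_homology_def free.carrier_homology free.mult_homology free.one_homology)

text \<open>Both ends of a loop are \<open>x\<close>, which is zero in the reduced
  \<open>0\<close>-chains.\<close>

lemma hurewicz_closed: "A \<in> carrier (pi1 X x) \<Longrightarrow> hurewicz X x A \<in> carrier (reduced_homology 1 X x)"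
proof -
  interpret G0: comm_group "grp (free_cubical X x) 0" by (rule comm_group_free)
  assume "A \<in> carrier (pi1 X x)"
  then obtain u where u: "A = cls u" "u \<in> loops X x" unfolding carrier_pi1 by blast
  then have "cub_diff (free_cubical X x) 1 (unit_map X x 1 u) = \<one>\<^bsub>grp (free_cubical X x) 0\<^esub>"
    using unit_map_closed[of u 1]
    by (simp add: free.cub_diff_1 loops_def edge_end_unit_map unit_map_base)
  with u show ?thesis using unit_map_closed[of u 1] by (auto simp: hurewicz_cls reduced_homology_1 loops_def)
qed

end

context connected_kan
begin

text \<open>The chosen paths give a map from \<open>0\<close>-chains to \<open>1\<close>-chains, and \<open>c\<close> minus the image of its boundary
  is homologous to a combination of straightened edges. For a cycle the correction vanishes.\<close>

lemma hurewicz_surj: "carrier (reduced_homology 1 X x) \<subseteq> hurewicz X x ` carrier (pi1 X x)"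
proof -
  let ?A = "free_cubical X x" and ?Q = "free.chain_quotient"
  interpret Q: comm_group ?Q by (rule free.chain_quotient_comm_group)
  interpret h: group_hom "pi1 X x" ?Q "hurewicz X x" by (rule hurewicz_hom)
  interpret c: group_hom "grp ?A 1" ?Q free.chain_class by (rule free.chain_class_hom)
  interpret d: group_hom "grp ?A 1" "grp ?A 0" "cub_diff ?A 1" by (rule free.cub_diff_1_hom)
  have path_class: "edge_class (path v) \<in> carrier ?Q" if "v \<in> cells X 0" for v
    using edge_class_closed path(1)[OF that] .
  \<comment> \<open>The choice of paths extends linearly to the reduced \<open>0\<close>-chains only
    if the path to \<open>x\<close> has trivial class.\<close>
  have "edge_class (path (const_cube X x 0)) = \<one>\<^bsub>?Q\<^esub>"
    using edge_class_const[OF base] by (simp add: const_cube_0 base path_base)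
  then obtain q where q_hom: "group_hom (grp ?A 0) ?Q q"
    and q: "\<And>v. v \<in> cells X 0 \<Longrightarrow> q (unit_map X x 0 v) = edge_class (path v)"
    using free_universal[OF Q.comm_group_axioms, of "\<lambda>v. edge_class (path v)" 0] path_class by blast
  interpret q: group_hom "grp ?A 0" ?Q q by (rule q_hom)
  \<comment> \<open>A cycle need not be a combination of loops, so the map is defined on all chains,
    where it is enough to know it on single edges.\<close>
  define D where "D a = free.chain_class a \<otimes>\<^bsub>?Q\<^esub> inv\<^bsub>?Q\<^esub> q (cub_diff ?A 1 a)" for a
  have D: "group_hom (grp ?A 1) ?Q D"
    by unfold_locales (auto simp: hom_def D_def Q.inv_mult Q.m_ac)
  have gen: "D (unit_map X x 1 e) \<in> hurewicz X x ` carrier (pi1 X x)" if e: "e \<in> cells X 1" for e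
  proof -
    define p where "p \<epsilon> = edge_class (path (edge_end X \<epsilon> e))" for \<epsilon>
    have ends: "edge_end X \<epsilon> e \<in> cells X 0" for \<epsilon> using e by (rule edge_end_closed)
    have car: "p \<epsilon> \<in> carrier ?Q" "edge_class e \<in> carrier ?Q" "edge_class (straighten e) \<in> carrier ?Q" for \<epsilon>
      using path_class[OF ends] edge_class_closed e straighten_in_loops[OF e] by (auto simp: p_def loops_def)
    have "q (cub_diff ?A 1 (unit_map X x 1 e)) = inv\<^bsub>?Q\<^esub> p False \<otimes>\<^bsub>?Q\<^esub> p True"
      using unit_map_closed[OF e] unit_map_closed[OF ends]
      by (simp add: free.cub_diff_1 edge_end_unit_map e q ends p_def)
    then have "D (unit_map X x 1 e) = (p False \<otimes>\<^bsub>?Q\<^esub> edge_class e) \<otimes>\<^bsub>?Q\<^esub> inv\<^bsub>?Q\<^esub> p True"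
      using car by (simp add: D_def Q.inv_mult Q.m_ac)
    also have "\<dots> = (edge_class (straighten e) \<otimes>\<^bsub>?Q\<^esub> p True) \<otimes>\<^bsub>?Q\<^esub> inv\<^bsub>?Q\<^esub> p True"
      using edge_class_square[OF straighten_square[OF e]] by (simp add: p_def)
    also have "\<dots> = edge_class (straighten e)"
      using car by (simp add: Q.m_assoc)
    also have "\<dots> = hurewicz X x (cls (straighten e))"
      using straighten_in_loops[OF e] by (simp add: hurewicz_cls)
    finally show ?thesis using straighten_in_loops[OF e] by (auto simp: carrier_pi1)
  qed
  show ?thesis
  proof
    fix y assume "y \<in> carrier (reduced_homology 1 X x)"
    then obtain a where a: "a \<in> carrier (grp ?A 1)" "cub_diff ?A 1 a = \<one>\<^bsub>grp ?A 0\<^esub>" "y = free.chain_class a"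
      unfolding reduced_homology_1 by blast
    \<comment> \<open>The image of the Hurewicz map is a subgroup, so its containing the values on
      edges suffices.\<close>
    have "D a \<in> hurewicz X x ` carrier (pi1 X x)"
      by (rule free_hom_in_subgroup[OF D h.img_is_subgroup gen a(1)])
    moreover have "D a = y" using a by (simp add: D_def)
    ultimately show "y \<in> hurewicz X x ` carrier (pi1 X x)" by simp
  qed
qed

text \<open>The homomorphism \<open>g\<close> on chains, built from \<open>\<alpha>\<close> with
  values in the abelianization, vanishes on null-homologous chains and returns the coset of a loop
  class. Conversely the target is abelian, so commutators go to the unit.\<close>

lemma kernel_hurewicz: "kernel (pi1 X x) free.chain_quotient (hurewicz X x) = derived (pi1 X x) (carrier (pi1 X x))"
proof -
  let ?A = "free_cubical X x" and ?Q = "free.chain_quotient" and ?D = "derived (pi1 X x) (carrier (pi1 X x))"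
  let ?G = "pi1 X x Mod ?D"
  interpret Q: comm_group ?Q by (rule free.chain_quotient_comm_group)
  interpret h: group_hom "pi1 X x" ?Q "hurewicz X x" by (rule hurewicz_hom)
  interpret D: normal ?D "pi1 X x" by (rule h.G.derived_self_is_normal)
  interpret G: comm_group ?G by (rule h.G.derived_quot_is_comm_group)
  interpret p: group_hom "pi1 X x" ?G "\<lambda>c. ?D #>\<^bsub>pi1 X x\<^esub> c"
    using D.r_coset_hom_Mod h.G.is_group G.is_group by (simp add: group_hom_def group_hom_axioms_def)
  define \<alpha> where "\<alpha> e = ?D #>\<^bsub>pi1 X x\<^esub> cls (straighten e)" for e
  have str: "cls (straighten e) \<in> carrier (pi1 X x)" if "e \<in> cells X 1" for e
    using straighten_in_loops[OF that] by (simp add: carrier_pi1)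
  have \<alpha>: "\<alpha> e \<in> carrier ?G" if "e \<in> cells X 1" for e
    unfolding \<alpha>_def by (rule p.hom_closed[OF str[OF that]])
  have \<alpha>_const: "\<alpha> (const_loop X v) = \<one>\<^bsub>?G\<^esub>" if "v \<in> cells X 0" for v
    unfolding \<alpha>_def straighten_const[OF that] using p.hom_one by (simp add: one_pi1)
  have \<alpha>_square: "\<alpha> l \<otimes>\<^bsub>?G\<^esub> \<alpha> t = \<alpha> b \<otimes>\<^bsub>?G\<^esub> \<alpha> r" if "square X l t b r" for l t b r
    unfolding \<alpha>_def using straighten_mult[OF that] str square_ends(1-4)[OF that]
    by (metis p.hom_mult)
  have \<alpha>_Pi: "\<alpha> \<in> cells X 1 \<rightarrow> carrier ?G" using \<alpha> by blast
  have "\<alpha> (const_cube X x 1) = \<one>\<^bsub>?G\<^esub>" using \<alpha>_const[OF base] by (simp add: const_cube_1)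
  then obtain g where g_hom: "group_hom (grp ?A 1) ?G g"
    and g: "\<And>e. e \<in> cells X 1 \<Longrightarrow> g (unit_map X x 1 e) = \<alpha> e"
    using free_universal[OF G.comm_group_axioms \<alpha>_Pi] by blast
  interpret g: group_hom "grp ?A 1" ?G g by (rule g_hom)
  \<comment> \<open>Composed with the degeneracy, \<open>g\<close> is a homomorphism on
    \<open>0\<close>-chains, so vertices suffice; boundaries are reduced to single squares in the
    same way.\<close>
  have g_const: "g (const_loop (underlying ?A) v) = \<one>\<^bsub>?G\<^esub>" if "v \<in> carrier (grp ?A 0)" for v
  proof -
    interpret s: group_hom "grp ?A 0" "grp ?A 1" "const_loop (underlying ?A)" by (rule free.const_loop_hom)
    have "group_hom (grp ?A 0) ?G (g \<circ> const_loop (underlying ?A))"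
      using hom_compose[OF s.homh g.homh] s.G.is_group G.is_group by (simp add: group_hom_def group_hom_axioms_def)
    then show ?thesis
      using free_hom_trivial[of 0 ?G "g \<circ> const_loop (underlying ?A)" v] that
      by (simp add: const_loop_unit_map g const_loop_closed \<alpha>_const)
  qed
  have g_boundary: "g (cub_diff ?A 2 z) = \<one>\<^bsub>?G\<^esub>" if "z \<in> carrier (grp ?A 2)" for z
  proof -
    interpret d: group_hom "grp ?A 2" "grp ?A 1" "cub_diff ?A 2" by (rule free.cub_diff_2_hom)
    have hom: "group_hom (grp ?A 2) ?G (g \<circ> cub_diff ?A 2)"
      using hom_compose[OF d.homh g.homh] d.G.is_group G.is_group by (simp add: group_hom_def group_hom_axioms_def)
    have "g (cub_diff ?A 2 (unit_map X x 2 s)) = \<one>\<^bsub>?G\<^esub>" if s: "s \<in> cells X 2" for s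
    proof -
      define l t b r where "l = square_side X 1 False s" and "t = square_side X 2 True s"
        and "b = square_side X 2 False s" and "r = square_side X 1 True s"
      have car: "l \<in> cells X 1" "t \<in> cells X 1" "b \<in> cells X 1" "r \<in> cells X 1"
        unfolding l_def t_def b_def r_def using square_side_closed s by simp_all
      have "square X l t b r" using s by (auto simp: square_def l_def t_def b_def r_def)
      then have lt: "\<alpha> l \<otimes>\<^bsub>?G\<^esub> \<alpha> t = \<alpha> b \<otimes>\<^bsub>?G\<^esub> \<alpha> r" by (rule \<alpha>_square)
      have "g (cub_diff ?A 2 (unit_map X x 2 s)) =
          (inv\<^bsub>?G\<^esub> \<alpha> l \<otimes>\<^bsub>?G\<^esub> \<alpha> r) \<otimes>\<^bsub>?G\<^esub> (\<alpha> b \<otimes>\<^bsub>?G\<^esub> inv\<^bsub>?G\<^esub> \<alpha> t)"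
        using unit_map_closed[OF s] car unit_map_closed[of _ 1]
        by (simp add: free.cub_diff_2 square_side_unit_map s g del: mult_FactGroup flip: l_def t_def b_def r_def)
      \<comment> \<open>Commutativity of the quotient enters here: it regroups the signed sides into
        \<open>b r\<close> against \<open>l t\<close>.\<close>
      also have "\<dots> = (\<alpha> b \<otimes>\<^bsub>?G\<^esub> \<alpha> r) \<otimes>\<^bsub>?G\<^esub> inv\<^bsub>?G\<^esub> (\<alpha> l \<otimes>\<^bsub>?G\<^esub> \<alpha> t)"
        using \<alpha> car by (simp add: G.inv_mult G.m_ac del: mult_FactGroup)
      also have "\<dots> = \<one>\<^bsub>?G\<^esub>"
        unfolding lt using \<alpha> car by (simp del: mult_FactGroup one_FactGroup)
      finally show ?thesis .
    qed
    then show ?thesis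
      using free_hom_trivial[OF hom _ that] by simp
  qed
  show ?thesis
  proof
    show "kernel (pi1 X x) ?Q (hurewicz X x) \<subseteq> ?D"
    proof
      fix C assume "C \<in> kernel (pi1 X x) ?Q (hurewicz X x)"
      then obtain u where u: "u \<in> loops X x" "C = cls u" "edge_class u = \<one>\<^bsub>?Q\<^esub>"
        by (auto simp: kernel_def carrier_pi1 hurewicz_cls)
      then have u1: "u \<in> cells X 1" by (simp add: loops_def)
      have "\<alpha> u = \<one>\<^bsub>?G\<^esub>"
        using free.chain_class_kernel[OF g_hom unit_map_closed[OF u1] u(3) g_const g_boundary] g[OF u1] by simp
      then have "?D #>\<^bsub>pi1 X x\<^esub> C = ?D"
        by (simp add: \<alpha>_def straighten_loop u)
      moreover have "C \<in> carrier (pi1 X x)" using u by (simp add: carrier_pi1)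
      ultimately show "C \<in> ?D" using h.G.rcos_self[OF _ D.is_subgroup] by blast
    qed
    have "derived ?Q (hurewicz X x ` carrier (pi1 X x)) = hurewicz X x ` ?D"
      by (rule h.derived_img) simp
    moreover have "derived ?Q (hurewicz X x ` carrier (pi1 X x)) = {\<one>\<^bsub>?Q\<^esub>}"
      by (rule Q.derived_eq_singleton) auto
    ultimately show "?D \<subseteq> kernel (pi1 X x) ?Q (hurewicz X x)"
      using D.subset by (auto simp: kernel_def)
  qed
qed

end

theorem theorem4p15:
  fixes X :: "'a cubical" and x :: 'a
  assumes "pointed_cubical_set X x" and "kan_complex X" and "zero_connected X"
  shows "hurewicz X x \<in> epi (pi1 X x) (reduced_homology 1 X x) \<and>
    kernel (pi1 X x) (reduced_homology 1 X x) (hurewicz X x) =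
      derived (pi1 X x) (carrier (pi1 X x))"
proof -
  interpret cubical_set X using assms(1) by (simp add: pointed_cubical_set_def)
  interpret connected_kan X x
    using assms by unfold_locales (auto simp: pointed_cubical_set_def)
  interpret h: group_hom "pi1 X x" free.chain_quotient "hurewicz X x" by (rule hurewicz_hom)
  have "hurewicz X x \<in> hom (pi1 X x) (reduced_homology 1 X x)"
    using hurewicz_closed h.hom_mult by (auto simp: hom_def reduced_homology_1)
  moreover have "hurewicz X x ` carrier (pi1 X x) = carrier (reduced_homology 1 X x)"
    using hurewicz_closed hurewicz_surj by blast
  \<comment> \<open>A kernel sees its target only through the unit, which the homology group shares
    with \<open>chain_quotient\<close>.\<close>
  moreover have "kernel (pi1 X x) (reduced_homology 1 X x) (hurewicz X x) =
      kernel (pi1 X x) free.chain_quotient (hurewicz X x)"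
    by (simp only: kernel_def reduced_homology_1)
  ultimately show ?thesis by (simp only: epi_def kernel_hurewicz mem_Collect_eq simp_thms)
qed

end
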